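(* Let $X$ be a finite connected symmetric digraph with all $d_v\ge1$ and a voltage assignment $\alpha:E(X)\to\Gamma\simeq\mathbb Z_p^d$. Let $\pi:Y\to X$ be a finite connected unramified Galois cover with Galois group $G$, with the pullback weight and the pullback voltage assignment $\alpha\circ\pi_E$. Let $K/\mathbb Q_p$ be a finite extension containing the weights and over which $G$ splits. Then \[ \mathcal F_Y(A,T)=\prod_{\rho\in\widehat G}\mathcal F_{X,\rho}(A,T)^{d_\rho}. \] Consequently, for every monic polynomial $P(A)\in K[A]$, \[ \mathcal R_{Y,P}(T)=\prod_{\rho\in\widehat G}\mathcal R_{X,P,\rho}(T)^{d_\rho}. \]
   Context: Let $p$ be a prime and $d\ge1$. A finite symmetric digraph $X$ has a finite vertex set $V(X)=\{v_1,\dots,v_m\}$ and a finite set $E(X)$ of directed edges (loops and multiple edges allowed) with origin $o(e)$, terminus $t(e)$ and an inversion $e\mapsto\bar e\ne e$ with $\bar{\bar e}=e$, $o(\bar e)=t(e)$. Put $d_v=\#\{e:o(e)=v\}$ and $w(e)=2/d_{o(e)}$ (Grover weight). A voltage assignment into $\Gamma\simeq\mathbb Z_p^d$ satisfies $\alpha(\bar e)=-\alpha(e)$. Cover. Write $Y=X(G,\beta)$ with $\beta:E(X)\to G$, $\beta(\bar e)=\beta(e)^{-1}$: $V(Y)=V(X)\times G$, with directed edges $(e,g):(o(e),g)\to(t(e),g\beta(e))$. $\pi_E:E(Y)\to E(X)$ is $(e,g)\mapsto e$. The weight on $Y$ is $w(\tilde e)=w(\pi_E(\tilde e))$. "$G$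 splits over $K$" means $K$ is a splitting field for $G$; $\widehat G$ is the set of isomorphism classes of irreducible $K$-representations $\rho$ of $G$, and $d_\rho=\dim\rho$. Spectral elements. For $\gamma\in\Gamma$ put $\tau(\gamma)=\prod_i(1+T_i)^{\gamma_i}\in\mathbb Z_p[[T_1,\dots,T_d]]$. Let $D^W(X)=\operatorname{diag}\bigl(\sum_{o(e)=v_i}w(e)\bigr)_i=2I_m$ and similarly $D^W(Y)=2I_{m|G|}$. Let $W^Y$ be the $m|G|\times m|G|$ matrix indexed by $V(Y)$ with $(u,v)$ entry $\sum_{\tilde e:u\to v}w(\tilde e)\tau(\alpha(\pi_E(\tilde e)))$, and $\mathcal F_Y(A,T)=\det\bigl(A^2I_{m|G|}-AW^Y+D^W(Y)-I_{m|G|}\bigr)$. For $\rho\in\widehat G$ let $W_{\rho,\tau,\alpha}$ be the $m\times m$ block matrix with $(i,j)$ block $\sum_{e:v_i\to v_j}w(e)\tau(\alpha(e))\rho(\beta(e))$ (a $d_\rho\times d_\rho$ matrix), and $\mathcal F_{X,\rho}(A,T)=\det\bigl(A^2I_{md_\rho}-AW_{\rho,\tau,\alpha}+(D^W(X)-I_m)\otimes I_{d_\rho}\bigr)$. All these are monic in $A$ with coefficients in $K[[T_1,\dots,T_d]]$. Resultants: for monic $f=\prod_i(A-\alpha_i)$ over an algebraically closed field, $\operatorname{Res}_A(f,g)=\prod_ig(\alpha_i)$. Put $\mathcal R_{Y,P}=\operatorname{Res}_A(\mathcal F_Y,P)$ and $\mathcal R_{X,P,\rho}=\operatorname{Res}_A(\mathcal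 F_{X,\rho},P)$. *)

theory Defs
  imports
    "HOL-Library.Function_Algebras"
    "HOL-Algebra.Algebraic_Closure_Type"
    "HOL-Computational_Algebra.Fraction_Field"
    "Berlekamp_Zassenhaus.Finite_Field"
    "Graph_Theory.Graph_Theory"
    "Subresultants.Subresultant_Gcd"
    "Jordan_Normal_Form.VS_Connect"
begin

(* frees the name X, used for digraphs *)
no_notation Polynomials.var (\<open>X\<index>\<close>)

text \<open>
  The prime \<open>p\<close> is \<open>CARD('p)\<close>. A \<open>p\<close>-adic integer is a compatible family of residues
  modulo \<open>p ^ n\<close>, i.e. an element of the inverse limit of the rings \<open>\<int>/p^n\<close>.
\<close>

typedef (overloaded) 'p::prime_card padic_int =
  "{x :: nat \<Rightarrow> int. \<forall>n. x n \<in> {0..<int CARD('p) ^ n} \<and> x (Suc n) mod int CARD('p) ^ n = x n}"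
  morphisms padic_residue Abs_padic_int
  by (rule exI[of _ "\<lambda>_. 0"]) (simp add: zero_less_power prime_gt_0_int prime_card_int)

setup_lifting type_definition_padic_int

lemma padic_p_pos: "int CARD('p::prime_card) ^ n > 0"
  by (simp add: zero_less_card_finite)

lemma padic_p_dvd: "int CARD('p::prime_card) ^ n dvd int CARD('p) ^ Suc n"
  by simp

lemma padic_coherent:
  fixes f :: "nat \<Rightarrow> int"
  assumes "\<And>n. [f (Suc n) = f n] (mod int CARD('p::prime_card) ^ n)"
  shows "\<forall>n. f n mod int CARD('p) ^ n \<in> {0..<int CARD('p) ^ n} \<and>
    f (Suc n) mod int CARD('p) ^ Suc n mod int CARD('p) ^ n = f n mod int CARD('p) ^ n"
proof (intro allI conjI)
  fix n
  show "f n mod int CARD('p) ^ n \<in> {0..<int CARD('p) ^ n}"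
    using padic_p_pos[where 'p='p, of n] by simp
  show "f (Suc n) mod int CARD('p) ^ Suc n mod int CARD('p) ^ n = f n mod int CARD('p) ^ n"
    using assms[of n] by (simp only: mod_mod_cancel[OF padic_p_dvd] cong_def)
qed

lemma padic_cong:
  assumes "\<forall>n. x n \<in> {0..<int CARD('p::prime_card) ^ n} \<and> x (Suc n) mod int CARD('p) ^ n = x n"
  shows "[x (Suc n) = x n] (mod int CARD('p) ^ n)"
  using assms by (metis cong_def mod_mod_trivial)

instantiation padic_int :: (prime_card) comm_ring_1
begin

lift_definition zero_padic_int :: "'a padic_int" is "\<lambda>_. 0"
  by (simp add: padic_p_pos)

lift_definition one_padic_int :: "'a padic_int" is "\<lambda>n. 1 mod int CARD('a) ^ n"
  by (intro allI padic_coherent[THEN spec]) simp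

lift_definition plus_padic_int :: "'a padic_int \<Rightarrow> 'a padic_int \<Rightarrow> 'a padic_int"
  is "\<lambda>x y n. (x n + y n) mod int CARD('a) ^ n"
  by (intro allI padic_coherent[THEN spec], intro cong_add padic_cong) auto

lift_definition times_padic_int :: "'a padic_int \<Rightarrow> 'a padic_int \<Rightarrow> 'a padic_int"
  is "\<lambda>x y n. (x n * y n) mod int CARD('a) ^ n"
  by (intro allI padic_coherent[THEN spec], intro cong_mult padic_cong) auto

lift_definition uminus_padic_int :: "'a padic_int \<Rightarrow> 'a padic_int"
  is "\<lambda>x n. (- x n) mod int CARD('a) ^ n"
  by (intro allI padic_coherent[THEN spec]) (use padic_cong in \<open>auto simp: cong_minus_minus_iff\<close>)

lift_definition minus_padic_int :: "'a padic_int \<Rightarrow> 'a padic_int \<Rightarrow> 'a padic_int"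
  is "\<lambda>x y n. (x n - y n) mod int CARD('a) ^ n"
  by (intro allI padic_coherent[THEN spec], intro cong_diff padic_cong) auto

instance
proof
  fix a b c :: "'a padic_int"
  show "a * b * c = a * (b * c)"
    by transfer (simp add: mod_simps algebra_simps)
  show "a * b = b * a"
    by transfer (simp add: mult.commute)
  show "1 * a = a"
    by transfer (auto simp: fun_eq_iff mod_simps)
  show "a + b + c = a + (b + c)"
    by transfer (simp add: mod_simps algebra_simps)
  show "a + b = b + a"
    by transfer (simp add: add.commute)
  show "0 + a = a"
    by transfer (auto simp: fun_eq_iff)
  show "- a + a = 0"
    by transfer (auto simp: fun_eq_iff mod_simps)
  show "a - b = a + - b"
    by transfer (auto simp: fun_eq_iff mod_simps)
  show "(a + b) * c = a * c + b * c"
    by transfer (simp add: mod_simps algebra_simps)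
  show "(0::'a padic_int) \<noteq> 1"
  proof transfer
    have "1 mod int CARD('a) ^ 1 = 1"
      using prime_card_int[where 'a='a] prime_gt_1_int by fastforce
    then show "(\<lambda>_. 0) \<noteq> (\<lambda>n. 1 mod int CARD('a) ^ n)"
      by (metis zero_neq_one)
  qed
qed

end

lemma padic_residue_add: "padic_residue (x + y :: 'p::prime_card padic_int) n
    = (padic_residue x n + padic_residue y n) mod int CARD('p) ^ n"
  by transfer simp

lemma padic_residue_mult: "padic_residue (x * y :: 'p::prime_card padic_int) n
    = (padic_residue x n * padic_residue y n) mod int CARD('p) ^ n"
  by transfer simp

lemma padic_residue_of_nat: "padic_residue (of_nat k :: 'p::prime_card padic_int) n
    = int k mod int CARD('p) ^ n"
proof (induction k)
  case 0
  show ?case by (simp add: zero_padic_int.rep_eq)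
next
  case (Suc k)
  then show ?case
    by (simp add: padic_residue_add one_padic_int.rep_eq mod_simps)
qed

lemma padic_residue_mod:
  "m \<le> n \<Longrightarrow> padic_residue (x :: 'p::prime_card padic_int) n mod int CARD('p) ^ m = padic_residue x m"
proof (induction n)
  case 0
  have "padic_residue x 0 \<in> {0..<int CARD('p) ^ 0}"
    using padic_residue[of x] by blast
  then show ?case using 0 by simp
next
  case (Suc n)
  have x: "padic_residue x (Suc n) mod int CARD('p) ^ n = padic_residue x n"
       "padic_residue x (Suc n) \<in> {0..<int CARD('p) ^ Suc n}"
    using padic_residue[of x] by blast+
  show ?case
  proof (cases "m = Suc n")
    case True
    then show ?thesis using x by (simp del: power_Suc)
  next
    case False
    then have "m \<le> n" using Suc by simp
    then have "int CARD('p) ^ m dvd int CARD('p) ^ n" by (simp add: le_imp_power_dvd)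
    then show ?thesis using Suc \<open>m \<le> n\<close> x by (metis mod_mod_cancel)
  qed
qed

lemma padic_residue_nonzero:
  assumes "(x :: 'p::prime_card padic_int) \<noteq> 0"
  obtains a where "\<And>n. a \<le> n \<Longrightarrow> \<not> int CARD('p) ^ a dvd padic_residue x n"
proof -
  from assms obtain a where a: "padic_residue x a \<noteq> 0"
    by (metis padic_residue_inject zero_padic_int.rep_eq ext)
  show ?thesis
  proof (rule that[of a])
    fix n assume "a \<le> n"
    then show "\<not> int CARD('p) ^ a dvd padic_residue x n"
      using a padic_residue_mod[of a n x] by (metis dvd_eq_mod_eq_0)
  qed
qed

instance padic_int :: (prime_card) idom
proof
  fix x y :: "'a padic_int"
  assume "x \<noteq> 0" "y \<noteq> 0"
  then obtain a b where
    a: "\<And>n. a \<le> n \<Longrightarrow> \<not> int CARD('a) ^ a dvd padic_residue x n" and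
    b: "\<And>n. b \<le> n \<Longrightarrow> \<not> int CARD('a) ^ b dvd padic_residue y n"
    by (metis padic_residue_nonzero)
  define u v where "u = padic_residue x (a + b)" and "v = padic_residue y (a + b)"
  have p: "prime (int CARD('a))" by (rule prime_card_int)
  have u: "\<not> int CARD('a) ^ a dvd u" and v: "\<not> int CARD('a) ^ b dvd v"
    using a[of "a + b"] b[of "a + b"] by (auto simp: u_def v_def)
  then have nz: "u \<noteq> 0" "v \<noteq> 0" by auto
  have "multiplicity (int CARD('a)) u < a" "multiplicity (int CARD('a)) v < b"
    using u v multiplicity_dvd' not_less by blast+
  then have "multiplicity (int CARD('a)) (u * v) < a + b"
    using p nz by (simp add: prime_elem_multiplicity_mult_distrib)
  then have "\<not> int CARD('a) ^ (a + b) dvd u * v"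
    using nz p by (subst power_dvd_iff_le_multiplicity) (auto simp: prime_int_iff)
  then have "padic_residue (x * y) (a + b) \<noteq> 0"
    by (simp add: padic_residue_mult u_def v_def dvd_eq_mod_eq_0)
  then show "x * y \<noteq> 0" by (auto simp: zero_padic_int.rep_eq)
qed

instance padic_int :: (prime_card) ring_char_0
proof
  show "inj (of_nat :: nat \<Rightarrow> 'a padic_int)"
  proof (rule injI)
    fix k l :: nat
    assume eq: "(of_nat k :: 'a padic_int) = of_nat l"
    define n where "n = k + l"
    have "CARD('a) > 1" using prime_card[where 'a='a] prime_gt_1_nat by blast
    then have "n < CARD('a) ^ n" by (simp add: power_gt_expt)
    then have "int k < int CARD('a) ^ n" "int l < int CARD('a) ^ n"
      unfolding n_def by (metis add_lessD1 add.commute of_nat_less_iff of_nat_power)+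
    then show "k = l"
      using arg_cong[OF eq, of "\<lambda>x. padic_residue x n"]
      by (simp add: padic_residue_of_nat)
  qed
qed

type_synonym 'p padic = "'p padic_int fract"

instance fract :: ("{idom, ring_char_0}") field_char_0
proof
  have "(of_nat n :: 'a fract) = to_fract (of_nat n)" for n
    by (induction n) (auto simp: to_fract_def One_fract_def Zero_fract_def)
  then show "inj (of_nat :: nat \<Rightarrow> 'a fract)"
    by (auto simp: inj_def to_fract_def eq_fract)
qed

text \<open>
  Formal power series over \<open>'a\<close> in the variables \<open>T i\<close> for \<open>i :: 'd\<close>, as functions from exponents
  to coefficients; the number of variables is \<open>CARD('d)\<close>.
\<close>

typedef ('d, 'a) mps = "UNIV :: (('d::finite \<Rightarrow> nat) \<Rightarrow> 'a) set"
  morphisms mps_coeff Abs_mps ..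

setup_lifting type_definition_mps

lemma mps_eqI: "(\<And>n. mps_coeff f n = mps_coeff g n) \<Longrightarrow> f = g"
  by (metis mps_coeff_inject ext)

definition antidiag :: "('d::finite \<Rightarrow> nat) \<Rightarrow> (('d \<Rightarrow> nat) \<times> ('d \<Rightarrow> nat)) set" where
  "antidiag n = {(a, b). a + b = n}"

lemma finite_antidiag [simp]: "finite (antidiag n)"
proof -
  have "finite (\<Pi>\<^sub>E i\<in>UNIV. {..n i})"
    by (rule finite_PiE) auto
  moreover have "antidiag n \<subseteq> (\<Pi>\<^sub>E i\<in>UNIV. {..n i}) \<times> (\<Pi>\<^sub>E i\<in>UNIV. {..n i})"
    by (auto simp: antidiag_def)
  ultimately show ?thesis
    by (meson finite_SigmaI finite_subset)
qed

lemma antidiag_0 [simp]: "antidiag 0 = {(0, 0)}"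
  by (auto simp: antidiag_def fun_eq_iff)

instantiation mps :: (finite, comm_ring_1) comm_ring_1
begin

lift_definition zero_mps :: "('a, 'b) mps" is "\<lambda>_. 0" .
lift_definition one_mps :: "('a, 'b) mps" is "\<lambda>n. if n = 0 then 1 else 0" .
lift_definition plus_mps :: "('a, 'b) mps \<Rightarrow> ('a, 'b) mps \<Rightarrow> ('a, 'b) mps" is "\<lambda>f g n. f n + g n" .
lift_definition minus_mps :: "('a, 'b) mps \<Rightarrow> ('a, 'b) mps \<Rightarrow> ('a, 'b) mps" is "\<lambda>f g n. f n - g n" .
lift_definition uminus_mps :: "('a, 'b) mps \<Rightarrow> ('a, 'b) mps" is "\<lambda>f n. - f n" .
lift_definition times_mps :: "('a, 'b) mps \<Rightarrow> ('a, 'b) mps \<Rightarrow> ('a, 'b) mps"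
  is "\<lambda>f g n. \<Sum>(a, b)\<in>antidiag n. f a * g b" .

instance
proof
  fix f g h :: "('a, 'b) mps"
  show "f * g = g * f"
    by (transfer, rule ext, rule sum.reindex_bij_witness[of _ prod.swap prod.swap])
       (auto simp: antidiag_def add.commute mult.commute)
  show "f * g * h = f * (g * h)"
  proof (transfer, rule ext)
    fix f g h :: "('a \<Rightarrow> nat) \<Rightarrow> 'b" and n :: "'a \<Rightarrow> nat"
    have "(\<Sum>(a, b)\<in>antidiag n. (\<Sum>(a, b)\<in>antidiag a. f a * g b) * h b) =
        (\<Sum>(u, v)\<in>(SIGMA u:antidiag n. antidiag (fst u)). f (fst v) * g (snd v) * h (snd u))"
      by (subst sum.Sigma[symmetric]) (simp_all add: sum_distrib_right case_prod_unfold)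
    also have "\<dots> = (\<Sum>(u, v)\<in>(SIGMA u:antidiag n. antidiag (snd u)). f (fst u) * (g (fst v) * h (snd v)))"
      by (rule sum.reindex_bij_witness[of _
            "\<lambda>(u, v). ((fst u + fst v, snd v), (fst u, fst v))"
            "\<lambda>(u, v). ((fst v, snd v + snd u), (snd v, snd u))"])
         (auto simp: antidiag_def algebra_simps)
    also have "\<dots> = (\<Sum>(a, b)\<in>antidiag n. f a * (\<Sum>(a, b)\<in>antidiag b. g a * h b))"
      by (subst sum.Sigma[symmetric]) (simp_all add: sum_distrib_left case_prod_unfold)
    finally show "(\<Sum>(a, b)\<in>antidiag n. (\<Sum>(a, b)\<in>antidiag a. f a * g b) * h b) =
        (\<Sum>(a, b)\<in>antidiag n. f a * (\<Sum>(a, b)\<in>antidiag b. g a * h b))" .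
  qed
  show "1 * f = f"
  proof (transfer, rule ext)
    fix f :: "('a \<Rightarrow> nat) \<Rightarrow> 'b" and n :: "'a \<Rightarrow> nat"
    have "(\<Sum>(a, b)\<in>antidiag n. (if a = 0 then 1 else 0) * f b) =
        (\<Sum>(a, b)\<in>{(0 :: 'a \<Rightarrow> nat, n)}. (if a = 0 then 1 else 0) * f b)"
      by (rule sum.mono_neutral_right[OF finite_antidiag]) (auto simp: antidiag_def split: if_splits)
    then show "(\<Sum>(a, b)\<in>antidiag n. (if a = 0 then 1 else 0) * f b) = f n"
      by simp
  qed
  show "f + g + h = f + (g + h)" by transfer (simp add: add.assoc)
  show "f + g = g + f" by transfer (simp add: add.commute)
  show "0 + f = f" by transfer simp
  show "- f + f = 0" by transfer simp
  show "f - g = f + - g" by transfer simp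
  show "(f + g) * h = f * h + g * h"
    by transfer (simp add: distrib_right sum.distrib case_prod_unfold)
  show "(0 :: ('a, 'b) mps) \<noteq> 1"
    by transfer (metis zero_neq_one)
qed

end

lemma mps_coeff_mult: "mps_coeff (f * g) n = (\<Sum>(a, b)\<in>antidiag n. mps_coeff f a * mps_coeff g b)"
  by (simp add: times_mps.rep_eq)

lemma exists_monomial_weight:
  "\<exists>\<phi> :: ('d::finite \<Rightarrow> nat) \<Rightarrow> nat. inj \<phi> \<and> (\<forall>a b. \<phi> (a + b) = \<phi> a * \<phi> b) \<and> (\<forall>a. \<phi> a > 0)"
proof -
  obtain B where B: "finite B" "card B = CARD('d)" "B \<subseteq> {p::nat. prime p}"
    using infinite_arbitrarily_large[OF primes_infinite, of "CARD('d)"] by blast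
  then obtain q :: "'d \<Rightarrow> nat" where "bij_betw q UNIV B"
    using finite_same_card_bij[of "UNIV :: 'd set" B] by auto
  then have q: "inj q" "range q \<subseteq> {p. prime p}"
    using B by (auto simp: bij_betw_def)
  then have pr: "prime (q i)" for i by auto
  define \<phi> where "\<phi> = (\<lambda>a. \<Prod>i\<in>UNIV. q i ^ a i)"
  have pos: "\<phi> a > 0" for a
    unfolding \<phi>_def using pr by (intro prod_pos) (auto simp: prime_gt_0_nat)
  have mult: "multiplicity (q i) (\<phi> a) = a i" for i a
  proof -
    have "multiplicity (q i) (\<phi> a) = (\<Sum>j\<in>UNIV. multiplicity (q i) (q j ^ a j))"
      unfolding \<phi>_def using pr
      by (intro prime_elem_multiplicity_prod_distrib) (auto simp: prime_gt_0_nat image_iff)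
    also have "\<dots> = (\<Sum>j\<in>UNIV. if j = i then a j else 0)"
      using q(1) pr by (intro sum.cong refl)
        (auto simp: prime_multiplicity_other multiplicity_distinct_prime_power inj_eq prime_gt_0_nat
          multiplicity_same_power)
    finally show ?thesis by simp
  qed
  have "inj \<phi>" by (rule injI) (metis mult ext)
  moreover have "\<phi> (a + b) = \<phi> a * \<phi> b" for a b
    by (simp add: \<phi>_def power_add prod.distrib)
  ultimately show ?thesis using pos by blast
qed

text \<open>
  Weighing the exponent \<open>a\<close> by a product of distinct prime powers \<open>q i ^ a i\<close> orders the exponents
  compatibly with addition, so that series have a least nonzero term.
\<close>

instance mps :: (finite, idom) idom
proof
  fix f g :: "('a, 'b) mps"
  assume fg: "f \<noteq> 0" "g \<noteq> 0"
  obtain \<phi> :: "('a \<Rightarrow> nat) \<Rightarrow> nat"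
    where \<phi>: "inj \<phi>" "\<And>a b. \<phi> (a + b) = \<phi> a * \<phi> b" "\<And>a. \<phi> a > 0"
    using exists_monomial_weight by blast
  have least: "\<exists>a. mps_coeff h a \<noteq> 0 \<and> (\<forall>b. mps_coeff h b \<noteq> 0 \<longrightarrow> \<phi> a \<le> \<phi> b)"
    if "h \<noteq> 0" for h :: "('a, 'b) mps"
  proof -
    have "\<exists>a. mps_coeff h a \<noteq> 0"
      using that by (metis mps_eqI zero_mps.rep_eq)
    then show ?thesis
      using ex_has_least_nat[of "\<lambda>a. mps_coeff h a \<noteq> 0" _ \<phi>] by blast
  qed
  obtain a where a: "mps_coeff f a \<noteq> 0" "\<And>b. mps_coeff f b \<noteq> 0 \<Longrightarrow> \<phi> a \<le> \<phi> b"
    using least[OF fg(1)] by blast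
  obtain b where b: "mps_coeff g b \<noteq> 0" "\<And>c. mps_coeff g c \<noteq> 0 \<Longrightarrow> \<phi> b \<le> \<phi> c"
    using least[OF fg(2)] by blast
  have "mps_coeff f c * mps_coeff g d = 0" if "c + d = a + b" "(c, d) \<noteq> (a, b)" for c d
  proof (rule ccontr)
    assume "mps_coeff f c * mps_coeff g d \<noteq> 0"
    then have le: "\<phi> a \<le> \<phi> c" "\<phi> b \<le> \<phi> d" using a b by auto
    have eq: "\<phi> c * \<phi> d = \<phi> a * \<phi> b" using that(1) \<phi>(2) by metis
    have "\<phi> c = \<phi> a"
    proof (rule ccontr)
      assume "\<phi> c \<noteq> \<phi> a"
      then have "\<phi> a * \<phi> b < \<phi> c * \<phi> d"
        using le \<phi>(3) by (intro mult_less_le_imp_less) auto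
      then show False using eq by simp
    qed
    then have "c = a" using \<phi>(1) by (simp add: inj_eq)
    then show False using that by simp
  qed
  then have "(case x of (c, d) \<Rightarrow> mps_coeff f c * mps_coeff g d) = 0"
    if "x \<in> antidiag (a + b) - {(a, b)}" for x
    using that by (cases x) (simp add: antidiag_def del: mult_eq_0_iff)
  then have "mps_coeff (f * g) (a + b) = (\<Sum>(c, d)\<in>{(a, b)}. mps_coeff f c * mps_coeff g d)"
    unfolding mps_coeff_mult
    by (intro sum.mono_neutral_right finite_antidiag ballI) (simp_all only: antidiag_def, simp_all)
  then show "f * g \<noteq> 0"
    using a b by (auto simp: zero_mps.rep_eq)
qed

lift_definition mps_const :: "'a::zero \<Rightarrow> ('d::finite, 'a) mps" is "\<lambda>c n. if n = 0 then c else 0" .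

lift_definition mps_map :: "('a \<Rightarrow> 'b) \<Rightarrow> ('d::finite, 'a) mps \<Rightarrow> ('d, 'b) mps" is "\<lambda>h f n. h (f n)" .

text \<open>The binomial series \<open>(1 + T i) ^ c = (\<Sum>k. (c gchoose k) * T i ^ k)\<close>.\<close>

lift_definition mps_binomial :: "'d::finite \<Rightarrow> 'a::field_char_0 \<Rightarrow> ('d, 'a) mps" is
  "\<lambda>i c n. if \<forall>j. j \<noteq> i \<longrightarrow> n j = 0 then c gchoose n i else 0" .

text \<open>
  The element \<open>\<tau>(\<gamma>) = (\<Prod>i. (1 + T i) ^ \<gamma> i)\<close>. Its coefficients are \<open>p\<close>-adic integers, as products of
  binomial coefficients of \<open>p\<close>-adic integers; they are computed in the fraction field because
  \<open>gchoose\<close> divides by a factorial.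
\<close>

definition volt_char :: "('d::finite \<Rightarrow> 'p::prime_card padic_int) \<Rightarrow> ('d, 'p padic) mps" where
  "volt_char \<gamma> = (\<Prod>i\<in>UNIV. mps_binomial i (to_fract (\<gamma> i)))"

lemma proots_alg_closed:
  fixes f :: "'a::alg_closed_field poly"
  assumes "f \<noteq> 0"
  shows "size (proots f) = degree f"
    and "poly f y = lead_coeff f * (\<Prod>x\<in>#proots f. y - x)"
proof -
  obtain A where A: "size A = degree f"
    and f: "f = Polynomial.smult (lead_coeff f) (\<Prod>x\<in>#A. [:-x, 1:])"
    using alg_closed_imp_factorization[OF assms] by blast
  have "proots f = proots (\<Prod>x\<in>#A. [:-x, 1:])"
    by (subst f) (use assms in simp)
  also have "\<dots> = A"
  proof (induction A)
    case (add x A)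
    have "proots ([:-x, 1:] * (\<Prod>x\<in>#A. [:-x, 1:])) = proots [:-x, 1:] + proots (\<Prod>x\<in>#A. [:-x, 1:])"
      by (intro proots_mult) (auto simp: prod_mset_zero_iff)
    also have "\<dots> = add_mset x A"
      by (simp only: proots_linear_factor minus_minus add.IH) simp
    finally show ?case by (simp only: image_mset_add_mset prod_mset.add_mset)
  qed simp
  finally have "proots f = A" .
  then show "size (proots f) = degree f" using A by simp
  show "poly f y = lead_coeff f * (\<Prod>x\<in>#proots f. y - x)"
    unfolding \<open>proots f = A\<close>
    by (subst f) (simp add: poly_prod_mset image_mset.compositionality o_def)
qed

text \<open>
  The library's \<open>resultant\<close> is the determinant of the Sylvester matrix. For a monic first argument it
  is the product of the values of the second one at the roots of the first in an algebraically closed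
  field; see \<open>resultant_monic_eq_prod_roots\<close> below.
\<close>

definition res_roots :: "'a::alg_closed_field poly \<Rightarrow> 'a poly \<Rightarrow> 'a" where
  "res_roots f g = lead_coeff f ^ degree g * (\<Prod>x\<in>#proots f. poly g x)"

lemma prod_mset_minus_swap:
  "(\<Prod>x\<in>#A. \<Prod>y\<in>#B. (x - y :: 'a::comm_ring_1)) = (-1) ^ (size A * size B) * (\<Prod>y\<in>#B. \<Prod>x\<in>#A. y - x)"
proof -
  have "(\<Prod>x\<in>#A. \<Prod>y\<in>#B. (x - y)) = (\<Prod>x\<in>#A. \<Prod>y\<in>#B. (-1) * (y - x))"
    by simp
  also have "\<dots> = (-1) ^ (size A * size B) * (\<Prod>x\<in>#A. \<Prod>y\<in>#B. y - x)"
    unfolding prod_mset.distrib by (simp add: power_mult[symmetric] mult.commute)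
  also have "(\<Prod>x\<in>#A. \<Prod>y\<in>#B. y - x) = (\<Prod>y\<in>#B. \<Prod>x\<in>#A. y - x)"
    by (rule prod_mset.swap)
  finally show ?thesis .
qed

lemma res_roots_swap:
  assumes "f \<noteq> 0" "g \<noteq> 0"
  shows "res_roots f g = (-1) ^ (degree f * degree g) * res_roots g f"
proof -
  have *: "res_roots f g = lead_coeff f ^ degree g * lead_coeff g ^ degree f
      * (\<Prod>x\<in>#proots f. \<Prod>y\<in>#proots g. x - y)" if "f \<noteq> 0" "g \<noteq> 0" for f g :: "'a poly"
    using that by (simp add: res_roots_def proots_alg_closed prod_mset.distrib)
  show ?thesis
    using *[OF assms] *[OF assms(2,1)] assms
    by (simp add: prod_mset_minus_swap[of "proots f"] proots_alg_closed(1) mult_ac)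
qed

lemma resultant_eq_res_roots_aux:
  fixes f g :: "'a::alg_closed_field poly"
  assumes "f \<noteq> 0" "g \<noteq> 0" "degree g \<le> degree f"
  shows "resultant f g = res_roots f g"
  using assms
proof (induction "degree g" arbitrary: f g rule: less_induct)
  case less
  show ?case
  proof (cases "degree g = 0")
    case True
    then obtain c where "g = [:c:]" by (metis degree_eq_zeroE)
    then show ?thesis using less.prems by (simp add: res_roots_def proots_alg_closed(1))
  next
    case False
    define h where "h = f mod g"
    have eq: "f + (- (f div g)) * g = h"
      by (simp add: h_def minus_div_mult_eq_mod[symmetric])
    have dh: "degree h < degree g"
      unfolding h_def using False less.prems by (metis degree_mod_less degree_0 neq0_conv)
    have root: "poly f y = poly h y" if "y \<in># proots g" for y
      using that less.prems by (simp add: eq[symmetric])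
    have prod: "(\<Prod>y\<in>#proots g. poly f y) = (\<Prod>y\<in>#proots g. poly h y)"
      using root by (intro arg_cong[of _ _ prod_mset] image_mset_cong) auto
    have sw: "res_roots f g = (-1) ^ (degree f * degree g) * (lead_coeff g ^ degree f * (\<Prod>y\<in>#proots g. poly h y))"
      using res_roots_swap[of f g] less.prems by (simp add: res_roots_def prod)
    show ?thesis
    proof (cases "degree h = 0")
      case True
      then obtain c where c: "h = [:c:]" by (metis degree_eq_zeroE)
      have "subresultant 0 f g = Polynomial.smult ((-1) ^ (degree f * degree g) * lead_coeff g ^ degree f * lead_coeff h ^ (degree g - 1)) h"
        using BT_lemma_1_13[OF eq less.prems(3) disjI1[OF dh] disjI1[OF dh]] True by simp
      then have "resultant f g = (-1) ^ (degree f * degree g) * lead_coeff g ^ degree f * c ^ degree g"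
        unfolding coeff_subresultant_0_0_resultant[symmetric] using c False
        by (simp add: power_eq_if)
      then show ?thesis using sw c less.prems by (simp add: proots_alg_closed(1))
    next
      case dh0: False
      have "subresultant 0 f g = Polynomial.smult ((-1) ^ (degree f * degree g) * lead_coeff g ^ (degree f - degree h)) (subresultant 0 g h)"
        using BT_lemma_1_12[OF eq less.prems(3) disjI1[OF dh], of 0] dh0 by simp
      then have "resultant f g = (-1) ^ (degree f * degree g) * lead_coeff g ^ (degree f - degree h) * resultant g h"
        unfolding coeff_subresultant_0_0_resultant[symmetric] by simp
      also have "resultant g h = res_roots g h"
        using less.hyps[of h g] less.prems dh dh0 by force
      finally show ?thesis
        unfolding sw using dh less.prems
        by (simp add: res_roots_def[of g h] power_add[symmetric] mult_ac)
    qed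
  qed
qed

lemma resultant_eq_res_roots:
  fixes f g :: "'a::alg_closed_field poly"
  assumes "f \<noteq> 0"
  shows "resultant f g = res_roots f g"
proof (cases "g = 0")
  case True
  then show ?thesis
    using resultant_const(2)[of f 0] assms by (simp add: res_roots_def proots_alg_closed(1))
next
  case False
  then show ?thesis
    using resultant_eq_res_roots_aux[of f g] resultant_eq_res_roots_aux[of g f]
      resultant_swap[of f g] res_roots_swap[of f g] assms
    by (cases "degree g \<le> degree f") auto
qed

interpretation to_ac_fract: inj_comm_ring_hom "\<lambda>x :: 'a::idom. to_ac (to_fract x)"
  by unfold_locales (auto simp: to_ac_add to_ac_mult)

lemma resultant_monic_eq_prod_roots:
  fixes f g :: "'a::idom poly"
  assumes "monic f"
  defines "\<iota> \<equiv> \<lambda>x :: 'a. to_ac (to_fract x)"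
  shows "\<iota> (resultant f g) = (\<Prod>a\<in>#proots (map_poly \<iota> f). poly (map_poly \<iota> g) a)"
proof -
  have "\<iota> (resultant f g) = resultant (map_poly \<iota> f) (map_poly \<iota> g)"
    unfolding \<iota>_def by (rule to_ac_fract.resultant_hom[symmetric])
  also have "\<dots> = res_roots (map_poly \<iota> f) (map_poly \<iota> g)"
    using assms(1) unfolding \<iota>_def by (intro resultant_eq_res_roots) auto
  finally show ?thesis
    using assms(1) by (simp add: res_roots_def \<iota>_def)
qed

definition finite_extension :: "('f::field \<Rightarrow> 'k::field) \<Rightarrow> bool" where
  "finite_extension \<iota> \<longleftrightarrow> comm_ring_hom \<iota> \<and>
     (\<exists>B. finite B \<and> (\<forall>x. \<exists>c. x = (\<Sum>b\<in>B. \<iota> (c b) * b)))"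

text \<open>
  Matrix representations. Only the values of \<open>\<rho>\<close> on \<open>carrier G\<close> matter, also for the equivalence
  of representations.
\<close>

definition rep_dim :: "('g, 'm) monoid_scheme \<Rightarrow> ('g \<Rightarrow> 'k mat) \<Rightarrow> nat" where
  "rep_dim G \<rho> = dim_row (\<rho> \<one>\<^bsub>G\<^esub>)"

definition representation :: "('g, 'm) monoid_scheme \<Rightarrow> ('g \<Rightarrow> 'k::field mat) \<Rightarrow> bool" where
  "representation G \<rho> \<longleftrightarrow>
     (\<forall>x\<in>carrier G. \<rho> x \<in> carrier_mat (rep_dim G \<rho>) (rep_dim G \<rho>)) \<and>
     \<rho> \<one>\<^bsub>G\<^esub> = 1\<^sub>m (rep_dim G \<rho>) \<and>
     (\<forall>x\<in>carrier G. \<forall>y\<in>carrier G. \<rho> (x \<otimes>\<^bsub>G\<^esub> y) = \<rho> x * \<rho> y)"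

definition irreducible_rep :: "('g, 'm) monoid_scheme \<Rightarrow> ('g \<Rightarrow> 'k::field mat) \<Rightarrow> bool" where
  "irreducible_rep G \<rho> \<longleftrightarrow> representation G \<rho> \<and> rep_dim G \<rho> > 0 \<and>
     (\<forall>U. VectorSpace.subspace class_ring U (module_vec TYPE('k) (rep_dim G \<rho>)) \<and>
          (\<forall>x\<in>carrier G. \<forall>u\<in>U. \<rho> x *\<^sub>v u \<in> U) \<longrightarrow>
          U = {0\<^sub>v (rep_dim G \<rho>)} \<or> U = carrier_vec (rep_dim G \<rho>))"

definition equivalent_reps ::
    "('g, 'm) monoid_scheme \<Rightarrow> ('g \<Rightarrow> 'k::field mat) \<Rightarrow> ('g \<Rightarrow> 'k mat) \<Rightarrow> bool" where
  "equivalent_reps G \<rho> \<sigma> \<longleftrightarrow> rep_dim G \<rho> = rep_dim G \<sigma> \<and>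
     (\<exists>Q\<in>carrier_mat (rep_dim G \<rho>) (rep_dim G \<rho>). invertible_mat Q \<and>
        (\<forall>x\<in>carrier G. Q * \<rho> x = \<sigma> x * Q))"

definition irr_classes :: "('g, 'm) monoid_scheme \<Rightarrow> ('g \<Rightarrow> 'k::field mat) set set" where
  "irr_classes G = {\<rho>. irreducible_rep G \<rho>} //
     {(\<rho>, \<sigma>). irreducible_rep G \<rho> \<and> irreducible_rep G \<sigma> \<and> equivalent_reps G \<rho> \<sigma>}"

text \<open>
  \<open>K\<close> is a splitting field for \<open>G\<close> if every irreducible representation over \<open>K\<close> is absolutely
  irreducible, i.e. stays irreducible over the algebraic closure of \<open>K\<close>.
\<close>

definition splitting_field :: "'k::field itself \<Rightarrow> ('g, 'm) monoid_scheme \<Rightarrow> bool" where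
  "splitting_field _ G \<longleftrightarrow>
     (\<forall>\<rho> :: 'g \<Rightarrow> 'k mat. irreducible_rep G \<rho> \<longrightarrow> irreducible_rep G (\<lambda>x. map_mat to_ac (\<rho> x)))"

text \<open>
  The derived digraph of a voltage assignment \<open>\<beta>\<close>, i.e. the Galois cover with group \<open>G\<close> that \<open>\<beta>\<close>
  describes. The covering map is \<open>fst\<close> on vertices and on edges.
\<close>

definition derived_digraph ::
    "('v, 'e) pre_digraph \<Rightarrow> ('g, 'm) monoid_scheme \<Rightarrow> ('e \<Rightarrow> 'g) \<Rightarrow> ('v \<times> 'g, 'e \<times> 'g) pre_digraph" where
  "derived_digraph X G \<beta> =
     \<lparr>verts = verts X \<times> carrier G,
      arcs = arcs X \<times> carrier G,
      tail = (\<lambda>(e, g). (tail X e, g)),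
      head = (\<lambda>(e, g). (head X e, g \<otimes>\<^bsub>G\<^esub> \<beta> e))\<rparr>"

definition derived_arev ::
    "('v, 'e) pre_digraph \<Rightarrow> ('g, 'm) monoid_scheme \<Rightarrow> ('e \<Rightarrow> 'g) \<Rightarrow> ('e \<Rightarrow> 'e) \<Rightarrow> 'e \<times> 'g \<Rightarrow> 'e \<times> 'g" where
  "derived_arev X G \<beta> arev =
     (\<lambda>(e, g). if e \<in> arcs X \<and> g \<in> carrier G then (arev e, g \<otimes>\<^bsub>G\<^esub> \<beta> e) else (e, g))"

lemma derived_digraph_symmetric:
  fixes X :: "('v, 'e) pre_digraph" and G :: "('g, 'm) monoid_scheme"
  assumes X: "fin_digraph X" "bidirected_digraph X arev"
    and G: "group G" "finite (carrier G)"
    and \<beta>: "\<And>e. e \<in> arcs X \<Longrightarrow> \<beta> e \<in> carrier G"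
      "\<And>e. e \<in> arcs X \<Longrightarrow> \<beta> (arev e) = inv\<^bsub>G\<^esub> (\<beta> e)"
  shows "fin_digraph (derived_digraph X G \<beta>)"
    and "bidirected_digraph (derived_digraph X G \<beta>) (derived_arev X G \<beta> arev)"
proof -
  interpret X: fin_digraph X by fact
  interpret B: bidirected_digraph X arev by fact
  interpret G: group G by fact
  interpret Y: fin_digraph "derived_digraph X G \<beta>"
    using G \<beta> by unfold_locales (auto simp: derived_digraph_def)
  show "fin_digraph (derived_digraph X G \<beta>)" by unfold_locales
  show "bidirected_digraph (derived_digraph X G \<beta>) (derived_arev X G \<beta> arev)"
  proof (rule Y.bidirected_digraphI)
    fix a :: "'e \<times> 'g"
    obtain e g where a: "a = (e, g)" by (cases a)
    show "a \<notin> arcs (derived_digraph X G \<beta>) \<Longrightarrow> derived_arev X G \<beta> arev a = a"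
      by (auto simp: a derived_digraph_def derived_arev_def)
    assume "a \<in> arcs (derived_digraph X G \<beta>)"
    then have eg: "e \<in> arcs X" "g \<in> carrier G" by (auto simp: a derived_digraph_def)
    note \<beta>e = \<beta>[OF eg(1)]
    have arev: "derived_arev X G \<beta> arev a = (arev e, g \<otimes>\<^bsub>G\<^esub> \<beta> e)"
      using eg by (simp add: a derived_arev_def)
    show "derived_arev X G \<beta> arev a \<noteq> a"
      using B.arev_neq eg arev by (simp add: a)
    show "tail (derived_digraph X G \<beta>) (derived_arev X G \<beta> arev a) = head (derived_digraph X G \<beta>) a"
      using eg by (simp add: arev, simp add: a derived_digraph_def)
    have "derived_arev X G \<beta> arev (arev e, g \<otimes>\<^bsub>G\<^esub> \<beta> e)
        = (arev (arev e), (g \<otimes>\<^bsub>G\<^esub> \<beta> e) \<otimes>\<^bsub>G\<^esub> \<beta> (arev e))"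
      using eg \<beta>e(1) by (simp add: derived_arev_def)
    also have "\<dots> = (e, g)"
      using eg \<beta>e by (simp add: G.m_assoc)
    finally show "derived_arev X G \<beta> arev (derived_arev X G \<beta> arev a) = a"
      by (simp add: arev, simp add: a)
  qed
qed

definition grover_weight :: "('v, 'e) pre_digraph \<Rightarrow> 'e \<Rightarrow> 'k::field" where
  "grover_weight X e = 2 / of_nat (out_degree X (tail X e))"

text \<open>
  In the matrices below, the distinct list \<open>vs\<close> enumerates the vertices of \<open>X\<close>.
\<close>

definition weight_degree_mat :: "('v, 'e) pre_digraph \<Rightarrow> 'v list \<Rightarrow> ('e \<Rightarrow> 'k::field) \<Rightarrow> 'k mat" where
  "weight_degree_mat X vs w = mat (length vs) (length vs)
     (\<lambda>(i, j). if i = j then \<Sum>e\<in>out_arcs X (vs ! i). w e else 0)"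

definition weighted_adjacency_mat ::
    "('v, 'e) pre_digraph \<Rightarrow> 'v list \<Rightarrow> ('e \<Rightarrow> 'r::comm_ring_1) \<Rightarrow> 'r mat" where
  "weighted_adjacency_mat X vs f = mat (length vs) (length vs)
     (\<lambda>(i, j). \<Sum>e | e \<in> arcs X \<and> tail X e = vs ! i \<and> head X e = vs ! j. f e)"

text \<open>
  The block matrix whose \<open>(i, j)\<close> block is the sum of the \<open>n \<times> n\<close> matrices \<open>f e * \<sigma> e\<close> over the edges
  \<open>e\<close> from \<open>vs ! i\<close> to \<open>vs ! j\<close>.
\<close>

definition twisted_adjacency_mat ::
    "('v, 'e) pre_digraph \<Rightarrow> 'v list \<Rightarrow> nat \<Rightarrow> ('e \<Rightarrow> 'r::comm_ring_1) \<Rightarrow> ('e \<Rightarrow> 'r mat) \<Rightarrow> 'r mat" where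
  "twisted_adjacency_mat X vs n f \<sigma> = mat (length vs * n) (length vs * n)
     (\<lambda>(r, c). \<Sum>e | e \<in> arcs X \<and> tail X e = vs ! (r div n) \<and> head X e = vs ! (c div n).
        f e * \<sigma> e $$ (r mod n, c mod n))"

definition kronecker :: "'r::comm_ring_1 mat \<Rightarrow> 'r mat \<Rightarrow> 'r mat" where
  "kronecker A B = mat (dim_row A * dim_row B) (dim_col A * dim_col B)
     (\<lambda>(r, c). A $$ (r div dim_row B, c div dim_col B) * B $$ (r mod dim_row B, c mod dim_col B))"

text \<open>The polynomial \<open>det (A\<^sup>2 I - A W + M)\<close> in the variable \<open>A\<close>.\<close>

definition spectral_det :: "'r::comm_ring_1 mat \<Rightarrow> 'r mat \<Rightarrow> 'r poly" where
  "spectral_det W M = det ([:0, 1:] ^ 2 \<cdot>\<^sub>m 1\<^sub>m (dim_row W)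
     - [:0, 1:] \<cdot>\<^sub>m map_mat (\<lambda>c. [:c:]) W + map_mat (\<lambda>c. [:c:]) M)"

definition voltage_weight ::
    "('p::prime_card padic \<Rightarrow> 'k::field) \<Rightarrow> ('e \<Rightarrow> 'k) \<Rightarrow> ('e \<Rightarrow> 'd::finite \<Rightarrow> 'p padic_int) \<Rightarrow>
      'e \<Rightarrow> ('d, 'k) mps" where
  "voltage_weight \<iota> w \<alpha> e = mps_const (w e) * mps_map \<iota> (volt_char (\<alpha> e))"

definition spectral_poly ::
    "('p::prime_card padic \<Rightarrow> 'k::field) \<Rightarrow> ('v, 'e) pre_digraph \<Rightarrow> 'v list \<Rightarrow> ('e \<Rightarrow> 'k) \<Rightarrow>
      ('e \<Rightarrow> 'd::finite \<Rightarrow> 'p padic_int) \<Rightarrow> ('d, 'k) mps poly" where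
  "spectral_poly \<iota> X vs w \<alpha> =
     spectral_det (weighted_adjacency_mat X vs (voltage_weight \<iota> w \<alpha>))
       (map_mat mps_const (weight_degree_mat X vs w - 1\<^sub>m (length vs)))"

definition twisted_spectral_poly ::
    "('p::prime_card padic \<Rightarrow> 'k::field) \<Rightarrow> ('v, 'e) pre_digraph \<Rightarrow> 'v list \<Rightarrow> ('e \<Rightarrow> 'k) \<Rightarrow>
      ('e \<Rightarrow> 'd::finite \<Rightarrow> 'p padic_int) \<Rightarrow> ('g, 'm) monoid_scheme \<Rightarrow> ('e \<Rightarrow> 'g) \<Rightarrow>
      ('g \<Rightarrow> 'k mat) \<Rightarrow> ('d, 'k) mps poly" where
  "twisted_spectral_poly \<iota> X vs w \<alpha> G \<beta> \<rho> =
     spectral_det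
       (twisted_adjacency_mat X vs (rep_dim G \<rho>) (voltage_weight \<iota> w \<alpha>)
          (\<lambda>e. map_mat mps_const (\<rho> (\<beta> e))))
       (map_mat mps_const
          (kronecker (weight_degree_mat X vs w - 1\<^sub>m (length vs)) (1\<^sub>m (rep_dim G \<rho>))))"

end

theory Submission
  imports Defs "Jordan_Normal_Form.Char_Poly"
begin

text \<open>
  The matrix of the cover is the image of one matrix over the group algebra of \<open>G\<close> under the regular
  representation, and the twisted matrix of \<open>\<rho>\<close> is its image under \<open>\<rho>\<close>. A composition series of the
  regular representation makes its image block triangular with irreducible blocks, so its determinant
  is the product of the determinants of the blocks. Since the trace of the regular representation
  vanishes away from \<open>1\<close>, the orthogonality of characters, valid over a splitting field of
  characteristic \<open>0\<close>, shows that each \<open>\<rho>\<close> occurs \<open>d\<^sub>\<rho>\<close> times. The resultants follow because the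
  resultant is multiplicative.
\<close>

section \<open>Determinants of matrices indexed by a finite set\<close>

text \<open>The matrices of the statement are indexed through lists, with \<open>div\<close> and
  \<open>mod\<close> for the blocks, and the list of vertices of the cover comes in an arbitrary
  order. Determinants are therefore taken of functions on finite index sets, where pairs of a vertex
  and a group element need no numbering. Two rings meet: representations have entries in
  \<open>K\<close>, while the matrices to be factored have entries in the polynomials in
  \<open>A\<close> over the power series. A homomorphism \<open>h\<close> carries the first ring
  into the second, so that every base change is made over a field and then transported. An edge
  \<open>e\<close> lifts to an edge from the fibre point \<open>g\<close> to the fibre point
  \<open>k\<close> exactly when \<open>\<beta> e = g^-1 k\<close>. Hence the entries of the matrix
  of the cover depend on \<open>g\<close> and \<open>k\<close> only through \<open>g^-1 k\<close>,
  which is the pattern of right translations. Orthogonality compares multiplicities only as elements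
  of \<open>K\<close>; characteristic 0 turns this into an equation of natural numbers.
  Multiplicativity of the resultant is applied to nonzero factors, and these are seen to be nonzero
  from their product.\<close>

lemma det_permute_rows_cols:
  assumes A: "A \<in> carrier_mat n n" and p: "p permutes {0..<n}"
  shows "det (mat n n (\<lambda>(i, j). A $$ (p i, p j))) = det A"
proof -
  have p_lt: "p i < n" if "i < n" for i
    using permutes_in_image[OF p, of i] that by simp
  define B where "B = mat n n (\<lambda>(i, j). A $$ (p i, j))"
  have B: "B \<in> carrier_mat n n" by (simp add: B_def)
  \<comment> \<open>The columns are permuted as rows of the transpose; the sign of \<open>p\<close>
    then occurs twice and cancels.\<close>
  have "mat n n (\<lambda>(i, j). A $$ (p i, p j)) = transpose_mat (mat n n (\<lambda>(i, j). transpose_mat B $$ (p i, j)))"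
    by (rule eq_matI) (use A p_lt in \<open>auto simp: B_def\<close>)
  then have "det (mat n n (\<lambda>(i, j). A $$ (p i, p j))) = det (mat n n (\<lambda>(i, j). transpose_mat B $$ (p i, j)))"
    by (simp add: det_transpose[where n = n])
  also have "\<dots> = signof p * (signof p * det A)"
    using B by (simp add: det_permute_rows[OF _ p, of "transpose_mat B"] det_transpose[OF B],
        simp add: B_def det_permute_rows[OF A p])
  finally show ?thesis
    by (simp add: sign_def split: if_splits)
qed

text \<open>The use of \<open>SOME\<close> is harmless: two enumerations differ by a permutation
  that acts on rows and columns alike. On an infinite \<open>S\<close> the value is the determinant
  of an empty matrix.\<close>

definition set_det :: "'i set \<Rightarrow> ('i \<Rightarrow> 'i \<Rightarrow> 'r::comm_ring_1) \<Rightarrow> 'r" where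
  "set_det S F = (let e = SOME e. bij_betw e {..<card S} S
     in det (mat (card S) (card S) (\<lambda>(i, j). F (e i) (e j))))"

lemma set_det_eq:
  assumes e: "bij_betw e {..<n} S"
  shows "set_det S F = det (mat n n (\<lambda>(i, j). F (e i) (e j)))"
proof -
  have n: "card S = n" using bij_betw_same_card[OF e] by simp
  define f where "f = (SOME e. bij_betw e {..<card S} S)"
  have f: "bij_betw f {..<n} S"
    unfolding f_def n by (rule someI[of "\<lambda>e. bij_betw e {..<n} S", OF e])
  \<comment> \<open>The transition from \<open>f\<close> to \<open>e\<close>, extended by the
    identity because \<open>permutes\<close> constrains all natural numbers.\<close>
  define p where "p = (\<lambda>i. if i < n then inv_into {..<n} f (e i) else i)"
  have "bij_betw (inv_into {..<n} f \<circ> e) {..<n} {..<n}"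
    using e bij_betw_inv_into[OF f] by (rule bij_betw_trans)
  then have "bij_betw p {..<n} {..<n}"
    by (rule bij_betw_cong[THEN iffD1, rotated]) (simp add: p_def)
  then have p: "p permutes {0..<n}"
    by (intro bij_imp_permutes) (auto simp: p_def lessThan_atLeast0)
  have fp: "f (p i) = e i" if "i < n" for i
    using bij_betw_inv_into_right[OF f, of "e i"] e that by (auto simp: p_def bij_betw_def)
  have pl: "p i < n" if "i < n" for i
    using permutes_in_image[OF p, of i] that by simp
  let ?A = "mat n n (\<lambda>(i, j). F (f i) (f j))"
  have "mat n n (\<lambda>(i, j). F (e i) (e j)) = mat n n (\<lambda>(i, j). ?A $$ (p i, p j))"
    by (rule eq_matI) (auto simp: fp pl)
  then show ?thesis
    using det_permute_rows_cols[OF _ p, of ?A] by (simp add: set_det_def n f_def Let_def)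
qed

lemma finite_enumeration:
  assumes "finite S"
  obtains e where "bij_betw e {..<card S} S"
  using ex_bij_betw_nat_finite[OF assms] by (auto simp: lessThan_atLeast0)

lemma set_det_cong:
  assumes "finite S" "\<And>a b. a \<in> S \<Longrightarrow> b \<in> S \<Longrightarrow> F a b = F' a b"
  shows "set_det S F = set_det S F'"
proof -
  obtain e where e: "bij_betw e {..<card S} S" using assms(1) by (rule finite_enumeration)
  then have "e i \<in> S" if "i < card S" for i using that by (auto simp: bij_betw_def)
  then show ?thesis
    unfolding set_det_eq[OF e] by (intro arg_cong[of _ _ det] eq_matI) (auto simp: assms(2))
qed

lemma set_det_empty [simp]: "set_det {} F = 1"
  by (subst set_det_eq[of "\<lambda>_. undefined" 0]) (auto simp: bij_betw_def)

lemma set_det_reindex: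
  assumes "finite S" "bij_betw f S T"
  shows "set_det T F = set_det S (\<lambda>a b. F (f a) (f b))"
proof -
  obtain e where e: "bij_betw e {..<card S} S" using assms(1) by (rule finite_enumeration)
  show ?thesis
    by (simp add: set_det_eq[OF e] set_det_eq[OF bij_betw_trans[OF e assms(2)]])
qed

lemma set_det_delta:
  assumes "finite S"
  shows "set_det S (\<lambda>a b. if a = b then 1 else 0 :: 'r::comm_ring_1) = 1"
proof -
  obtain e where e: "bij_betw e {..<card S} S" using assms(1) by (rule finite_enumeration)
  have "mat (card S) (card S) (\<lambda>(i, j). if e i = e j then 1 else 0 :: 'r) = 1\<^sub>m (card S)"
    using e by (intro eq_matI) (auto simp: bij_betw_def inj_on_def)
  then show ?thesis
    by (simp add: set_det_eq[OF e])
qed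

lemma set_det_mult:
  assumes "finite S"
  shows "set_det S F * set_det S F' = set_det S (\<lambda>a b. \<Sum>c\<in>S. F a c * F' c b)"
proof -
  obtain e where e: "bij_betw e {..<card S} S" using assms(1) by (rule finite_enumeration)
  let ?n = "card S"
  have "mat ?n ?n (\<lambda>(i, j). \<Sum>c\<in>S. F (e i) c * F' c (e j))
      = mat ?n ?n (\<lambda>(i, j). F (e i) (e j)) * mat ?n ?n (\<lambda>(i, j). F' (e i) (e j))"
    by (rule eq_matI)
      (auto simp: scalar_prod_def sum.reindex_bij_betw[OF e, symmetric] lessThan_atLeast0)
  then show ?thesis
    by (simp add: set_det_eq[OF e] det_mult[of _ ?n])
qed

lemma set_det_triangular:
  fixes F :: "'i \<Rightarrow> 'i \<Rightarrow> 'r::idom"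
  assumes fin: "finite S" "finite T" and disj: "S \<inter> T = {}"
    and zero: "\<And>a b. a \<in> T \<Longrightarrow> b \<in> S \<Longrightarrow> F a b = 0"
  shows "set_det (S \<union> T) F = set_det S F * set_det T F"
proof -
  let ?m = "card S" and ?n = "card T"
  obtain e where e: "bij_betw e {..<?m} S" using fin(1) by (rule finite_enumeration)
  obtain f where f: "bij_betw f {..<?n} T" using fin(2) by (rule finite_enumeration)
  \<comment> \<open>The indices in \<open>S\<close> come first, so that the vanishing block is the
    lower left one.\<close>
  define g where "g = (\<lambda>i. if i < ?m then e i else f (i - ?m))"
  have "bij_betw g {..<?m} S"
    using e by (rule bij_betw_cong[THEN iffD1, rotated]) (simp add: g_def)
  moreover have "bij_betw g {?m..<?m + ?n} T"
  proof -
    have "bij_betw (\<lambda>i. i - ?m) {?m..<?m + ?n} {..<?n}"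
      by (rule bij_betw_byWitness[of _ "\<lambda>i. i + ?m"]) auto
    from bij_betw_trans[OF this f] show ?thesis
      by (rule bij_betw_cong[THEN iffD1, rotated]) (simp add: g_def)
  qed
  ultimately have "bij_betw g ({..<?m} \<union> {?m..<?m + ?n}) (S \<union> T)"
    using disj by (rule bij_betw_combine)
  moreover have "{..<?m} \<union> {?m..<?m + ?n} = {..<?m + ?n}" by auto
  ultimately have g: "bij_betw g {..<?m + ?n} (S \<union> T)" by simp
  have eS: "e i \<in> S" if "i < ?m" for i using e that by (auto simp: bij_betw_def)
  have fT: "f i \<in> T" if "i < ?n" for i using f that by (auto simp: bij_betw_def)
  have "mat (?m + ?n) (?m + ?n) (\<lambda>(i, j). F (g i) (g j)) =
      four_block_mat (mat ?m ?m (\<lambda>(i, j). F (e i) (e j))) (mat ?m ?n (\<lambda>(i, j). F (e i) (f j)))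
        (0\<^sub>m ?n ?m) (mat ?n ?n (\<lambda>(i, j). F (f i) (f j)))"
    by (rule eq_matI) (auto simp: g_def zero eS fT)
  then show ?thesis
    by (simp add: set_det_eq[OF e] set_det_eq[OF f] set_det_eq[OF g]
        det_four_block_mat_lower_left_zero[of _ ?m _ ?n])
qed

lemma (in comm_ring_hom) set_det_hom:
  assumes "finite S"
  shows "hom (set_det S F) = set_det S (\<lambda>a b. hom (F a b))"
proof -
  obtain e where e: "bij_betw e {..<card S} S" using assms(1) by (rule finite_enumeration)
  show ?thesis
    unfolding set_det_eq[OF e] hom_det[symmetric]
    by (intro arg_cong[of _ _ det] eq_matI) auto
qed

section \<open>Matrices with entries in the group algebra\<close>

lemma mult_mat_entry:
  assumes "A \<in> carrier_mat n m" "B \<in> carrier_mat m k" "i < n" "j < k"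
  shows "(A * B) $$ (i, j) = (\<Sum>l<m. A $$ (i, l) * B $$ (l, j))"
  using assms by (auto simp: scalar_prod_def lessThan_atLeast0)

lemma sum_lessThan_add: "(\<Sum>i<r + s. f i) = (\<Sum>i<r. f i) + (\<Sum>i<s. f (r + i :: nat) :: 'a::comm_monoid_add)"
  by (induction s) (simp_all add: add.assoc)

definition mat_trace :: "'r::comm_ring_1 mat \<Rightarrow> 'r" where
  "mat_trace A = (\<Sum>i<dim_row A. A $$ (i, i))"

lemma mat_trace_mult_commute:
  assumes "A \<in> carrier_mat n m" "B \<in> carrier_mat m n"
  shows "mat_trace (A * B) = mat_trace (B * A)"
proof -
  have "mat_trace (A * B) = (\<Sum>i<n. \<Sum>k<m. A $$ (i, k) * B $$ (k, i))"
    using assms by (auto simp: mat_trace_def scalar_prod_def lessThan_atLeast0)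
  also have "\<dots> = (\<Sum>k<m. \<Sum>i<n. B $$ (k, i) * A $$ (i, k))"
    by (subst sum.swap) (simp add: mult.commute)
  also have "\<dots> = mat_trace (B * A)"
    using assms by (auto simp: mat_trace_def scalar_prod_def lessThan_atLeast0)
  finally show ?thesis .
qed

text \<open>
  The kernel of the block matrix \<open>\<Sum>x\<in>S. B x \<otimes> h (\<rho> x)\<close>, the image under \<open>\<rho>\<close> of a matrix over the
  group algebra whose coefficient matrices \<open>B x\<close> are indexed by arbitrary sets.
\<close>

definition tensor_kernel ::
    "'g set \<Rightarrow> ('k \<Rightarrow> 'r::comm_ring_1) \<Rightarrow> ('g \<Rightarrow> 'v \<Rightarrow> 'v \<Rightarrow> 'r) \<Rightarrow> ('g \<Rightarrow> 'k mat) \<Rightarrow>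
      'v \<times> nat \<Rightarrow> 'v \<times> nat \<Rightarrow> 'r" where
  "tensor_kernel S h B \<rho> a b =
     (\<Sum>x\<in>S. B x (fst a) (fst b) * h (\<rho> x $$ (snd a, snd b)))"

text \<open>The matrix \<open>I \<otimes> h A\<close>: a base change that acts on the representation
  space and leaves the index in \<open>V\<close> alone.\<close>

definition constant_kernel :: "('k \<Rightarrow> 'r::comm_ring_1) \<Rightarrow> 'k mat \<Rightarrow> 'v \<times> nat \<Rightarrow> 'v \<times> nat \<Rightarrow> 'r" where
  "constant_kernel h A a b = (if fst a = fst b then h (A $$ (snd a, snd b)) else 0)"

lemma sum_constant_kernel_left:
  assumes "finite V" "u \<in> V"
  shows "(\<Sum>c\<in>V \<times> {..<n}. constant_kernel h P (u, i) c * F c) = (\<Sum>k<n. h (P $$ (i, k)) * F (u, k))"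
proof -
  have "(\<Sum>c\<in>V \<times> {..<n}. constant_kernel h P (u, i) c * F c)
      = (\<Sum>v\<in>V. \<Sum>k<n. constant_kernel h P (u, i) (v, k) * F (v, k))"
    by (simp add: sum.cartesian_product)
  also have "\<dots> = (\<Sum>v\<in>V. if u = v then \<Sum>k<n. h (P $$ (i, k)) * F (u, k) else 0)"
    by (intro sum.cong) (auto simp: constant_kernel_def)
  finally show ?thesis using assms by simp
qed

lemma sum_constant_kernel_right:
  assumes "finite V" "v \<in> V"
  shows "(\<Sum>c\<in>V \<times> {..<n}. F c * constant_kernel h Q c (v, j)) = (\<Sum>k<n. F (v, k) * h (Q $$ (k, j)))"
proof -
  have "(\<Sum>c\<in>V \<times> {..<n}. F c * constant_kernel h Q c (v, j))
      = (\<Sum>u\<in>V. \<Sum>k<n. F (u, k) * constant_kernel h Q (u, k) (v, j))"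
    by (simp add: sum.cartesian_product)
  also have "\<dots> = (\<Sum>u\<in>V. if u = v then \<Sum>k<n. F (v, k) * h (Q $$ (k, j)) else 0)"
    by (intro sum.cong) (auto simp: constant_kernel_def)
  finally show ?thesis using assms by simp
qed

context
  fixes h :: "'k::comm_ring_1 \<Rightarrow> 'r::comm_ring_1" and V :: "'v set"
  assumes h: "comm_ring_hom h" and V: "finite V"
begin

interpretation h: comm_ring_hom h by (rule h)

text \<open>The product of \<open>I \<otimes> P\<close> and \<open>I \<otimes> Q\<close> is
  \<open>I \<otimes> (P * Q)\<close>, hence the identity matrix.\<close>

lemma set_det_constant_kernel_inverse:
  assumes P: "P \<in> carrier_mat n n" and Q: "Q \<in> carrier_mat n n" and PQ: "P * Q = 1\<^sub>m n"
  shows "set_det (V \<times> {..<n}) (constant_kernel h P) * set_det (V \<times> {..<n}) (constant_kernel h Q) = 1"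
proof -
  have fin: "finite (V \<times> {..<n})" using V by simp
  have eq: "(\<Sum>c\<in>V \<times> {..<n}. constant_kernel h P a c * constant_kernel h Q c b) = (if a = b then 1 else 0)"
    if "a \<in> V \<times> {..<n}" "b \<in> V \<times> {..<n}" for a b
  proof -
    obtain u i v j where ab: "a = (u, i)" "b = (v, j)" by (cases a, cases b)
    have "(\<Sum>c\<in>V \<times> {..<n}. constant_kernel h P a c * constant_kernel h Q c b)
        = (if u = v then h (\<Sum>k<n. P $$ (i, k) * Q $$ (k, j)) else 0)"
      using that V
      by (simp add: ab sum_constant_kernel_left) (simp add: constant_kernel_def h.hom_sum h.hom_mult)
    also have "(\<Sum>k<n. P $$ (i, k) * Q $$ (k, j)) = (P * Q) $$ (i, j)"
      using P Q that by (simp add: ab scalar_prod_def lessThan_atLeast0)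
    finally show ?thesis using that by (simp add: ab PQ)
  qed
  show ?thesis
    unfolding set_det_mult[OF fin] using eq
    by (subst set_det_cong[OF fin eq]) (simp_all add: set_det_delta[OF fin])
qed

text \<open>Conjugating every \<open>\<rho> x\<close> multiplies the kernel by
  \<open>I \<otimes> P\<close> on the left and by \<open>I \<otimes> Q\<close> on the right, because
  the coefficients \<open>B x\<close> live in the other tensor factor. The two extra determinants
  cancel.\<close>

lemma set_det_tensor_kernel_conj:
  assumes S: "finite S" and \<rho>: "\<And>x. x \<in> S \<Longrightarrow> \<rho> x \<in> carrier_mat n n"
    and P: "P \<in> carrier_mat n n" and Q: "Q \<in> carrier_mat n n" and PQ: "P * Q = 1\<^sub>m n"
  shows "set_det (V \<times> {..<n}) (tensor_kernel S h B (\<lambda>x. P * \<rho> x * Q))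
    = set_det (V \<times> {..<n}) (tensor_kernel S h B \<rho>)"
proof -
  let ?I = "V \<times> {..<n}"
  let ?K = "tensor_kernel S h B \<rho>" and ?P = "constant_kernel h P" and ?Q = "constant_kernel h Q"
  have fin: "finite ?I" using V by simp
  have eq: "tensor_kernel S h B (\<lambda>x. P * \<rho> x * Q) a b = (\<Sum>c\<in>?I. (\<Sum>d\<in>?I. ?P a d * ?K d c) * ?Q c b)"
    if "a \<in> ?I" "b \<in> ?I" for a b
  proof -
    obtain u i v j where ab: "a = (u, i)" "b = (v, j)" by (cases a, cases b)
    have entry: "(P * \<rho> x * Q) $$ (i, j) = (\<Sum>l<n. (\<Sum>k<n. P $$ (i, k) * \<rho> x $$ (k, l)) * Q $$ (l, j))"
      if "x \<in> S" for x
      using P Q \<rho>[OF that] \<open>a \<in> ?I\<close> \<open>b \<in> ?I\<close>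
      by (subst mult_mat_entry[of _ n n _ n]) (auto simp: ab mult_mat_entry[of _ n n _ n] simp del: index_mult_mat(1))
    have "(\<Sum>c\<in>?I. (\<Sum>d\<in>?I. ?P a d * ?K d c) * ?Q c b)
        = (\<Sum>l<n. (\<Sum>k<n. h (P $$ (i, k)) * (\<Sum>x\<in>S. B x u v * h (\<rho> x $$ (k, l)))) * h (Q $$ (l, j)))"
      using that V
      by (simp add: ab sum_constant_kernel_left sum_constant_kernel_right) (simp add: tensor_kernel_def)
    also have "\<dots> = (\<Sum>l<n. \<Sum>k<n. \<Sum>x\<in>S. B x u v * (h (P $$ (i, k)) * h (\<rho> x $$ (k, l)) * h (Q $$ (l, j))))"
      by (simp add: sum_distrib_left sum_distrib_right mult_ac)
    also have "\<dots> = (\<Sum>l<n. \<Sum>x\<in>S. \<Sum>k<n. B x u v * (h (P $$ (i, k)) * h (\<rho> x $$ (k, l)) * h (Q $$ (l, j))))"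
      by (intro sum.cong refl sum.swap)
    also have "\<dots> = (\<Sum>x\<in>S. \<Sum>l<n. \<Sum>k<n. B x u v * (h (P $$ (i, k)) * h (\<rho> x $$ (k, l)) * h (Q $$ (l, j))))"
      by (rule sum.swap)
    also have "\<dots> = tensor_kernel S h B (\<lambda>x. P * \<rho> x * Q) a b"
      unfolding tensor_kernel_def
      by (intro sum.cong refl)
        (simp add: ab entry h.hom_sum h.hom_mult sum_distrib_left sum_distrib_right)
    finally show ?thesis ..
  qed
  have "set_det ?I (tensor_kernel S h B (\<lambda>x. P * \<rho> x * Q)) = set_det ?I ?P * set_det ?I ?K * set_det ?I ?Q"
    unfolding set_det_mult[OF fin] by (rule set_det_cong[OF fin eq])
  also have "\<dots> = set_det ?I ?K"
  proof -
    have "a * b * c = b" if "a * c = 1" for a b c :: 'r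
    proof -
      have "a * b * c = a * c * b" by (simp only: mult_ac)
      then show ?thesis using that by simp
    qed
    then show ?thesis using set_det_constant_kernel_inverse[OF P Q PQ] .
  qed
  finally show ?thesis .
qed

end

section \<open>Subspaces and representations\<close>

lemma subspace_module_vec_iff:
  "VectorSpace.subspace class_ring U (module_vec TYPE('k::field) n) \<longleftrightarrow>
     U \<subseteq> carrier_vec n \<and> 0\<^sub>v n \<in> U \<and> (\<forall>u\<in>U. \<forall>v\<in>U. u + v \<in> U) \<and> (\<forall>c. \<forall>u\<in>U. c \<cdot>\<^sub>v u \<in> U)"
  using vec_vs[where 'a = 'k, of n] vec_module[where 'a = 'k, of n]
  by (auto simp: VectorSpace.subspace_def LinearCombinations.submodule_def module_vec_simps)

lemma obtain_inverse_mat: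
  fixes Q :: "'k::field mat"
  assumes "Q \<in> carrier_mat n n" "det Q \<noteq> 0"
  obtains P where "P \<in> carrier_mat n n" "P * Q = 1\<^sub>m n" "Q * P = 1\<^sub>m n"
  using det_non_zero_imp_unit[OF assms, of "()"] by (auto simp: Units_def ring_mat_def)

text \<open>
  A basis of \<open>U\<close> extended to a basis of the whole space: take an invertible \<open>Q\<close> with as many columns
  in \<open>U\<close> as possible. A vector of \<open>U\<close> outside the span of these columns could replace another one.
\<close>

lemma subspace_adapted_basis:
  fixes U :: "'k::field vec set"
  assumes U: "VectorSpace.subspace class_ring U (module_vec TYPE('k) n)"
  obtains Q r where "Q \<in> carrier_mat n n" "det Q \<noteq> 0" "r \<le> n" "\<And>j. j < r \<Longrightarrow> col Q j \<in> U"
    "\<And>c i. c \<in> carrier_vec n \<Longrightarrow> Q *\<^sub>v c \<in> U \<Longrightarrow> r \<le> i \<Longrightarrow> i < n \<Longrightarrow> c $ i = 0"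
proof -
  define good where "good = (\<lambda>r. r \<le> n \<and> (\<exists>Q\<in>carrier_mat n n. det Q \<noteq> 0 \<and> (\<forall>j<r. col Q j \<in> U)))"
  have "good 0" unfolding good_def by (auto intro!: bexI[of _ "1\<^sub>m n"])
  moreover have bound: "\<forall>r. good r \<longrightarrow> r \<le> n" by (auto simp: good_def)
  ultimately obtain r where r: "good r" and max: "\<And>s. good s \<Longrightarrow> s \<le> r"
    using Greatest_le_nat[of good _ n] GreatestI_nat[of good 0 n] by blast
  from r obtain Q where Q: "Q \<in> carrier_mat n n" "det Q \<noteq> 0" "\<And>j. j < r \<Longrightarrow> col Q j \<in> U" and rn: "r \<le> n"
    by (auto simp: good_def)
  show thesis
  proof (rule that[OF Q(1,2) rn Q(3)])
    fix c i
    assume c: "c \<in> carrier_vec n" "Q *\<^sub>v c \<in> U" and i: "r \<le> i" "i < n"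
    show "c $ i = 0"
    proof (rule ccontr)
      assume nz: "c $ i \<noteq> 0"
      define R where "R = replace_col Q (Q *\<^sub>v c) i"
      have R: "R \<in> carrier_mat n n" using Q(1) by (simp add: R_def replace_col_def)
      \<comment> \<open>By Cramer's rule, \<open>det R\<close> is \<open>c $ i\<close> times
        \<open>det Q\<close>.\<close>
      have dR: "det R \<noteq> 0"
        unfolding R_def cramer_lemma_mat[OF Q(1) c(1) i(2)] using nz Q(2) by simp
      have colR: "col R j = (if j = i then Q *\<^sub>v c else col Q j)" if "j < n" for j
        using that Q(1) by (intro eq_vecI) (auto simp: R_def replace_col_def)
      \<comment> \<open>The new column moves to position \<open>r\<close>, so that the first
        \<open>Suc r\<close> columns lie in \<open>U\<close>, against the maximality of
        \<open>r\<close>.\<close>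
      define T where "T = (if r = i then R else swapcols r i R)"
      have T: "T \<in> carrier_mat n n" using R by (simp add: T_def)
      have dT: "det T \<noteq> 0"
        using det_swapcols[of r n i R] i R dR by (auto simp: T_def)
      have "col T j \<in> U" if "j < Suc r" for j
      proof -
        have "col T j = (if j = r then col R i else col R j)"
          using that i R by (intro eq_vecI) (auto simp: T_def)
        then show ?thesis using that i colR[of i] colR[of j] c(2) Q(3)[of j] by auto
      qed
      then have "good (Suc r)"
        using T dT i unfolding good_def by auto
      from max[OF this] show False by simp
    qed
  qed
qed

lemma representationD:
  assumes "representation G \<rho>"
  shows "x \<in> carrier G \<Longrightarrow> \<rho> x \<in> carrier_mat (rep_dim G \<rho>) (rep_dim G \<rho>)"
    and "\<rho> \<one>\<^bsub>G\<^esub> = 1\<^sub>m (rep_dim G \<rho>)"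
    and "x \<in> carrier G \<Longrightarrow> y \<in> carrier G \<Longrightarrow> \<rho> (x \<otimes>\<^bsub>G\<^esub> y) = \<rho> x * \<rho> y"
  using assms by (auto simp: representation_def)

lemma representationI:
  assumes "\<And>x. x \<in> carrier G \<Longrightarrow> \<rho> x \<in> carrier_mat n n" "\<rho> \<one>\<^bsub>G\<^esub> = 1\<^sub>m n"
    "\<And>x y. x \<in> carrier G \<Longrightarrow> y \<in> carrier G \<Longrightarrow> \<rho> (x \<otimes>\<^bsub>G\<^esub> y) = \<rho> x * \<rho> y"
  shows "representation G \<rho>" "rep_dim G \<rho> = n"
  using assms by (auto simp: representation_def rep_dim_def)

lemma representation_conj:
  assumes \<rho>: "representation G \<rho>" and PQ: "P * Q = 1\<^sub>m n" "Q * P = 1\<^sub>m n"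
    and carr: "P \<in> carrier_mat n n" "Q \<in> carrier_mat n n" and n: "n = rep_dim G \<rho>"
  shows "representation G (\<lambda>x. P * \<rho> x * Q)" "rep_dim G (\<lambda>x. P * \<rho> x * Q) = n"
proof -
  show "rep_dim G (\<lambda>x. P * \<rho> x * Q) = n" using carr by (simp add: rep_dim_def)
  show "representation G (\<lambda>x. P * \<rho> x * Q)"
  proof (rule representationI(1))
    note \<rho>' = representationD[OF \<rho>, folded n]
    fix x assume x: "x \<in> carrier G"
    show "P * \<rho> x * Q \<in> carrier_mat n n" using \<rho>'(1)[OF x] carr by simp
    fix y assume y: "y \<in> carrier G"
    have "P * \<rho> x * Q * (P * \<rho> y * Q) = P * \<rho> x * (Q * P) * \<rho> y * Q"
      using \<rho>'(1)[OF x] \<rho>'(1)[OF y] carr by (simp add: assoc_mult_mat[of _ n n _ n _ n])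
    also have "\<dots> = P * \<rho> (x \<otimes>\<^bsub>G\<^esub> y) * Q"
      using \<rho>'(1)[OF x] \<rho>'(1)[OF y] carr by (simp add: \<rho>'(3)[OF x y] PQ assoc_mult_mat[of _ n n _ n _ n])
    finally show "P * \<rho> (x \<otimes>\<^bsub>G\<^esub> y) * Q = P * \<rho> x * Q * (P * \<rho> y * Q)" ..
  qed (use representationD(2)[OF \<rho>] PQ carr in \<open>simp add: n\<close>)
qed

text \<open>Upper triangular blocks suffice for determinants and traces, so Maschke's theorem is not needed.\<close>

lemma representation_block_triangular:
  fixes \<rho> :: "'g \<Rightarrow> 'k::field mat"
  assumes G: "group G" and \<rho>: "representation G \<rho>" "rep_dim G \<rho> = r + s"
    and zero0: "\<forall>x\<in>carrier G. \<forall>i<s. \<forall>j<r. \<rho> x $$ (r + i, j) = 0"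
  defines "\<rho>1 \<equiv> \<lambda>x. mat r r (\<lambda>(i, j). \<rho> x $$ (i, j))"
    and "\<rho>2 \<equiv> \<lambda>x. mat s s (\<lambda>(i, j). \<rho> x $$ (r + i, r + j))"
  shows "representation G \<rho>1" "rep_dim G \<rho>1 = r" "representation G \<rho>2" "rep_dim G \<rho>2 = s"
    "x \<in> carrier G \<Longrightarrow> mat_trace (\<rho> x) = mat_trace (\<rho>1 x) + mat_trace (\<rho>2 x)"
    "\<lbrakk>finite V; comm_ring_hom h\<rbrakk> \<Longrightarrow>
       set_det (V \<times> {..<r + s}) (tensor_kernel (carrier G) h B \<rho>)
       = set_det (V \<times> {..<r}) (tensor_kernel (carrier G) h B \<rho>1)
         * (set_det (V \<times> {..<s}) (tensor_kernel (carrier G) h B \<rho>2) :: 'r::idom)"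
proof -
  interpret G: group G by fact
  note \<rho>' = representationD[OF \<rho>(1), unfolded \<rho>(2)]
  note zero = zero0[rule_format]
  \<comment> \<open>The inner index of the matrix product is split at \<open>r\<close>. In the upper
    left block the second sum vanishes, in the lower right block the first one does; so both
    diagonal blocks are multiplicative.\<close>
  have prod: "\<rho> (x \<otimes>\<^bsub>G\<^esub> y) $$ (i, j)
      = (\<Sum>k<r. \<rho> x $$ (i, k) * \<rho> y $$ (k, j)) + (\<Sum>k<s. \<rho> x $$ (i, r + k) * \<rho> y $$ (r + k, j))"
    if "x \<in> carrier G" "y \<in> carrier G" "i < r + s" "j < r + s" for x y i j
  proof -
    have "\<rho> (x \<otimes>\<^bsub>G\<^esub> y) $$ (i, j) = (\<Sum>k<r + s. \<rho> x $$ (i, k) * \<rho> y $$ (k, j))"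
      using \<rho>'(1)[OF that(1)] \<rho>'(1)[OF that(2)] that
      by (simp add: \<rho>'(3) scalar_prod_def lessThan_atLeast0)
    then show ?thesis by (simp add: sum_lessThan_add)
  qed
  show "representation G \<rho>1" "rep_dim G \<rho>1 = r"
    by (rule representationI[where n = r];
        auto intro!: eq_matI simp: \<rho>1_def \<rho>'(2) prod zero scalar_prod_def lessThan_atLeast0)+
  show "representation G \<rho>2" "rep_dim G \<rho>2 = s"
    by (rule representationI[where n = s];
        auto intro!: eq_matI simp: \<rho>2_def \<rho>'(2) prod zero scalar_prod_def lessThan_atLeast0)+
  show "mat_trace (\<rho> x) = mat_trace (\<rho>1 x) + mat_trace (\<rho>2 x)" if "x \<in> carrier G"
    using \<rho>'(1)[OF that] by (simp add: mat_trace_def \<rho>1_def \<rho>2_def sum_lessThan_add)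
  have zero': "\<rho> x $$ (i, j) = 0" if "x \<in> carrier G" "r \<le> i" "i < r + s" "j < r" for x i j
    using zero[of x "i - r" j] that by simp
  assume V: "finite V" and "comm_ring_hom h"
  interpret h: comm_ring_hom h by fact
  let ?K = "tensor_kernel (carrier G) h B"
  have un: "V \<times> {..<r + s} = V \<times> {..<r} \<union> V \<times> {r..<r + s}" by auto
  have "set_det (V \<times> {..<r + s}) (?K \<rho>)
      = set_det (V \<times> {..<r}) (?K \<rho>) * set_det (V \<times> {r..<r + s}) (?K \<rho>)"
    unfolding un
  proof (rule set_det_triangular)
    fix a b assume ab: "a \<in> V \<times> {r..<r + s}" "b \<in> V \<times> {..<r}"
    then have "\<rho> x $$ (snd a, snd b) = 0" if "x \<in> carrier G" for x
      using zero'[OF that] by auto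
    then show "?K \<rho> a b = 0" by (simp add: tensor_kernel_def)
  qed (use V in auto)
  also have "set_det (V \<times> {..<r}) (?K \<rho>) = set_det (V \<times> {..<r}) (?K \<rho>1)"
    using V by (intro set_det_cong) (auto simp: tensor_kernel_def \<rho>1_def)
  also have "set_det (V \<times> {r..<r + s}) (?K \<rho>) = set_det (V \<times> {..<s}) (?K \<rho>2)"
  proof -
    have "bij_betw (\<lambda>(v, i). (v, r + i)) (V \<times> {..<s}) (V \<times> {r..<r + s})"
      by (rule bij_betw_byWitness[of _ "\<lambda>(v, i). (v, i - r)"]) auto
    then show ?thesis
      using V by (subst set_det_reindex) (auto intro!: set_det_cong simp: tensor_kernel_def \<rho>2_def)
  qed
  finally show "set_det (V \<times> {..<r + s}) (?K \<rho>)
      = set_det (V \<times> {..<r}) (?K \<rho>1) * set_det (V \<times> {..<s}) (?K \<rho>2)" .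
qed

section \<open>Composition series\<close>

lemma irreducible_repD:
  assumes "irreducible_rep G \<rho>"
  shows "representation G \<rho>" "rep_dim G \<rho> > 0"
    and "\<lbrakk>VectorSpace.subspace class_ring U (module_vec TYPE('k) (rep_dim G \<rho>));
      \<And>x u. x \<in> carrier G \<Longrightarrow> u \<in> U \<Longrightarrow> (\<rho> x :: 'k::field mat) *\<^sub>v u \<in> U\<rbrakk> \<Longrightarrow>
      U = {0\<^sub>v (rep_dim G \<rho>)} \<or> U = carrier_vec (rep_dim G \<rho>)"
  using assms unfolding irreducible_rep_def by blast+

lemma irreducible_repI:
  assumes "representation G \<rho>" "rep_dim G \<rho> > 0"
    and "\<And>U. VectorSpace.subspace class_ring U (module_vec TYPE('k) (rep_dim G \<rho>)) \<Longrightarrow>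
      (\<And>x u. x \<in> carrier G \<Longrightarrow> u \<in> U \<Longrightarrow> (\<rho> x :: 'k::field mat) *\<^sub>v u \<in> U) \<Longrightarrow>
      U = {0\<^sub>v (rep_dim G \<rho>)} \<or> U = carrier_vec (rep_dim G \<rho>)"
  shows "irreducible_rep G \<rho>"
  unfolding irreducible_rep_def using assms by blast

lemma mult_mat_zero_vec:
  "A \<in> carrier_mat n m \<Longrightarrow> A *\<^sub>v 0\<^sub>v m = (0\<^sub>v n :: 'k::comm_ring_1 vec)"
  by (intro eq_vecI) (auto simp: scalar_prod_def)

text \<open>Induction on the dimension: in a basis adapted to a proper invariant subspace the
  representation is block triangular, the trace is additive and the determinant multiplicative over
  the two blocks. A single list must serve for both, since the multiplicities found from the traces
  are used as exponents of the determinants.\<close>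

lemma composition_series:
  fixes \<rho> :: "'g \<Rightarrow> 'k::field mat"
  assumes G: "group G" and \<rho>: "representation G \<rho>" "finite (carrier G)"
    and V: "finite (V :: 'v set)" and h: "comm_ring_hom (h :: 'k \<Rightarrow> 'r::idom)"
  obtains \<sigma>s where "\<And>\<sigma>. \<sigma> \<in> set \<sigma>s \<Longrightarrow> irreducible_rep G \<sigma>"
    "\<And>x. x \<in> carrier G \<Longrightarrow> mat_trace (\<rho> x) = (\<Sum>\<sigma>\<leftarrow>\<sigma>s. mat_trace (\<sigma> x))"
    "\<And>B. set_det (V \<times> {..<rep_dim G \<rho>}) (tensor_kernel (carrier G) h B \<rho>)
      = (\<Prod>\<sigma>\<leftarrow>\<sigma>s. set_det (V \<times> {..<rep_dim G \<sigma>}) (tensor_kernel (carrier G) h B \<sigma>))"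
proof -
  let ?D = "\<lambda>B \<rho>. set_det (V \<times> {..<rep_dim G \<rho>}) (tensor_kernel (carrier G) h B \<rho>)"
  interpret G: group G by fact
  have "\<exists>\<sigma>s. (\<forall>\<sigma>\<in>set \<sigma>s. irreducible_rep G \<sigma>) \<and>
      (\<forall>x\<in>carrier G. mat_trace (\<rho> x) = (\<Sum>\<sigma>\<leftarrow>\<sigma>s. mat_trace (\<sigma> x))) \<and>
      (\<forall>B. ?D B \<rho> = (\<Prod>\<sigma>\<leftarrow>\<sigma>s. ?D B \<sigma>))"
    using \<rho>(1)
  proof (induction "rep_dim G \<rho>" arbitrary: \<rho> rule: less_induct)
    case less
    define n where "n = rep_dim G \<rho>"
    note \<rho> = representationD[OF less.prems, folded n_def]
    consider "n = 0" | "irreducible_rep G \<rho>" | "n > 0" "\<not> irreducible_rep G \<rho>" by auto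
    then show ?case
    proof cases
      case 1
      then have "mat_trace (\<rho> x) = 0" if "x \<in> carrier G" for x
        using \<rho>(1)[OF that] by (simp add: mat_trace_def)
      with 1 show ?thesis
        by (intro exI[of _ "[]"]) (simp add: n_def)
    next
      case 2
      then show ?thesis by (intro exI[of _ "[\<rho>]"]) simp
    next
      case 3
      then obtain U where U: "VectorSpace.subspace class_ring U (module_vec TYPE('k) n)"
        and inv: "\<And>x u. x \<in> carrier G \<Longrightarrow> u \<in> U \<Longrightarrow> \<rho> x *\<^sub>v u \<in> U"
        and proper: "U \<noteq> {0\<^sub>v n}" "U \<noteq> carrier_vec n"
        using irreducible_repI[OF less.prems] unfolding n_def by blast
      note U' = U[unfolded subspace_module_vec_iff]
      obtain Q r where Q: "Q \<in> carrier_mat n n" "det Q \<noteq> 0" and r: "r \<le> n"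
        and colU: "\<And>j. j < r \<Longrightarrow> col Q j \<in> U"
        and coord: "\<And>c i. c \<in> carrier_vec n \<Longrightarrow> Q *\<^sub>v c \<in> U \<Longrightarrow> r \<le> i \<Longrightarrow> i < n \<Longrightarrow> c $ i = 0"
        by (rule subspace_adapted_basis[OF U]) blast
      obtain P where P: "P \<in> carrier_mat n n" "P * Q = 1\<^sub>m n" "Q * P = 1\<^sub>m n"
        using obtain_inverse_mat[OF Q] by blast
      have QP: "Q *\<^sub>v (P *\<^sub>v u) = u" if "u \<in> carrier_vec n" for u
        using assoc_mult_mat_vec[OF Q(1) P(1) that] that by (simp add: P(3))
      \<comment> \<open>The case \<open>r = 0\<close> would make all coordinates of vectors of
        \<open>U\<close> vanish, and \<open>r = n\<close> would put a basis of the whole space into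
        \<open>U\<close>. Excluding both makes the two blocks strictly smaller, as the induction
        requires.\<close>
      have "r \<noteq> 0"
      proof
        assume "r = 0"
        have "u = 0\<^sub>v n" if "u \<in> U" for u
        proof -
          have u: "u \<in> carrier_vec n" using that U' by auto
          have "P *\<^sub>v u = 0\<^sub>v n"
            using coord[of "P *\<^sub>v u"] that P u QP[OF u] \<open>r = 0\<close> by (intro eq_vecI) auto
          then show ?thesis using QP[OF u] mult_mat_zero_vec[OF Q(1)] by simp
        qed
        then show False using proper(1) U' by blast
      qed
      have "r \<noteq> n"
      proof
        assume "r = n"
        \<comment> \<open>A matrix times a vector is a linear combination of the columns; partial
          sums over \<open>J\<close> allow an induction that uses only closure of \<open>U\<close>
          under sums and multiples.\<close>
        have comb: "finite J \<Longrightarrow> J \<subseteq> {..<n} \<Longrightarrow>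
            vec n (\<lambda>i. \<Sum>j\<in>J. c $ j * Q $$ (i, j)) \<in> U" for c :: "'k vec" and J
        proof (induction J rule: finite_induct)
          case empty
          have "vec n (\<lambda>i. 0 :: 'k) = 0\<^sub>v n" by auto
          then show ?case using U' by simp
        next
          case (insert j J)
          have "vec n (\<lambda>i. \<Sum>j\<in>insert j J. c $ j * Q $$ (i, j))
              = c $ j \<cdot>\<^sub>v col Q j + vec n (\<lambda>i. \<Sum>j\<in>J. c $ j * Q $$ (i, j))"
            using insert Q by (intro eq_vecI) auto
          then show ?case using insert colU \<open>r = n\<close> U' by auto
        qed
        have "u \<in> U" if u: "u \<in> carrier_vec n" for u
        proof -
          have "u = vec n (\<lambda>i. \<Sum>j\<in>{..<n}. (P *\<^sub>v u) $ j * Q $$ (i, j))"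
          proof (rule eq_vecI)
            fix i assume "i < dim_vec (vec n (\<lambda>i. \<Sum>j\<in>{..<n}. (P *\<^sub>v u) $ j * Q $$ (i, j)))"
            then have i: "i < n" by simp
            have "u $ i = (Q *\<^sub>v (P *\<^sub>v u)) $ i" using QP[OF u] by simp
            also have "\<dots> = (\<Sum>j\<in>{..<n}. Q $$ (i, j) * (P *\<^sub>v u) $ j)"
              using i P Q u by (simp add: scalar_prod_def lessThan_atLeast0 del: index_mult_mat_vec)
                (simp add: scalar_prod_def)
            finally show "u $ i = vec n (\<lambda>i. \<Sum>j\<in>{..<n}. (P *\<^sub>v u) $ j * Q $$ (i, j)) $ i"
              using i by (simp add: mult.commute)
          qed (use u in simp)
          then show ?thesis using comb[of "{..<n}" "P *\<^sub>v u"] by simp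
        qed
        then show False using proper(2) U' by blast
      qed
      define s where "s = n - r"
      have n: "n = r + s" and rs: "r < n" "s < n" using r \<open>r \<noteq> 0\<close> \<open>r \<noteq> n\<close> by (auto simp: s_def)
      define \<tau> where "\<tau> = (\<lambda>x. P * \<rho> x * Q)"
      have \<tau>: "representation G \<tau>" "rep_dim G \<tau> = r + s"
        using representation_conj[OF less.prems P(2,3,1) Q(1) n_def] by (simp_all add: \<tau>_def n)
      \<comment> \<open>Column \<open>j\<close> of \<open>\<tau> x\<close> lists the coordinates of
        \<open>\<rho> x *\<^sub>v col Q j\<close> in the basis \<open>Q\<close>. This vector lies in
        \<open>U\<close>, so its coordinates from \<open>r\<close> on vanish.\<close>
      have "\<tau> x $$ (r + i, j) = 0" if "x \<in> carrier G" "i < s" "j < r" for x i j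
      proof -
        have j: "j < n" using that(3) r by simp
        have carr: "\<tau> x \<in> carrier_mat n n" using P Q \<rho>(1)[OF that(1)] by (simp add: \<tau>_def)
        have "Q *\<^sub>v col (\<tau> x) j = col (Q * \<tau> x) j"
          using carr Q j by (simp add: col_mult2[of _ n n _ n])
        also have "Q * \<tau> x = \<rho> x * Q"
        proof -
          have "Q * \<tau> x = (Q * P) * (\<rho> x * Q)"
            unfolding \<tau>_def assoc_mult_mat[OF P(1) \<rho>(1)[OF that(1)] Q(1)]
            by (rule assoc_mult_mat[OF Q(1) P(1) mult_carrier_mat[OF \<rho>(1)[OF that(1)] Q(1)], symmetric])
          then show ?thesis using P(3) Q \<rho>(1)[OF that(1)] by simp
        qed
        also have "col (\<rho> x * Q) j = \<rho> x *\<^sub>v col Q j"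
          using Q j \<rho>(1)[OF that(1)] by (simp add: col_mult2[of _ n n _ n])
        finally have "Q *\<^sub>v col (\<tau> x) j \<in> U"
          using inv[OF that(1) colU[OF that(3)]] by simp
        from coord[OF _ this, of "r + i"] carr that(2) j n show ?thesis by simp
      qed
      then have zero: "\<forall>x\<in>carrier G. \<forall>i<s. \<forall>j<r. \<tau> x $$ (r + i, j) = 0" by blast
      note split = representation_block_triangular[OF G \<tau> zero]
      let ?\<tau>1 = "\<lambda>x. mat r r (\<lambda>(i, j). \<tau> x $$ (i, j))"
      let ?\<tau>2 = "\<lambda>x. mat s s (\<lambda>(i, j). \<tau> x $$ (r + i, r + j))"
      obtain \<sigma>1 where \<sigma>1: "\<forall>\<sigma>\<in>set \<sigma>1. irreducible_rep G \<sigma>"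
          "\<forall>x\<in>carrier G. mat_trace (?\<tau>1 x) = (\<Sum>\<sigma>\<leftarrow>\<sigma>1. mat_trace (\<sigma> x))"
          "\<forall>B. ?D B ?\<tau>1 = (\<Prod>\<sigma>\<leftarrow>\<sigma>1. ?D B \<sigma>)"
        using less.hyps[of ?\<tau>1] split(1,2) rs(1) unfolding n_def by auto
      obtain \<sigma>2 where \<sigma>2: "\<forall>\<sigma>\<in>set \<sigma>2. irreducible_rep G \<sigma>"
          "\<forall>x\<in>carrier G. mat_trace (?\<tau>2 x) = (\<Sum>\<sigma>\<leftarrow>\<sigma>2. mat_trace (\<sigma> x))"
          "\<forall>B. ?D B ?\<tau>2 = (\<Prod>\<sigma>\<leftarrow>\<sigma>2. ?D B \<sigma>)"
        using less.hyps[of ?\<tau>2] split(3,4) rs(2) unfolding n_def by auto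
      have "mat_trace (\<rho> x) = (\<Sum>\<sigma>\<leftarrow>\<sigma>1 @ \<sigma>2. mat_trace (\<sigma> x))" if x: "x \<in> carrier G" for x
      proof -
        have "mat_trace (\<tau> x) = mat_trace (Q * (P * \<rho> x))"
          unfolding \<tau>_def using P Q \<rho>(1)[OF x] by (intro mat_trace_mult_commute[of _ n n]) auto
        also have "Q * (P * \<rho> x) = (Q * P) * \<rho> x"
          by (rule assoc_mult_mat[OF Q(1) P(1) \<rho>(1)[OF x], symmetric])
        also have "\<dots> = \<rho> x" unfolding P(3) by (rule left_mult_one_mat[OF \<rho>(1)[OF x]])
        finally show ?thesis using split(5)[OF x] \<sigma>1(2) \<sigma>2(2) x by simp
      qed
      moreover have "?D B \<rho> = (\<Prod>\<sigma>\<leftarrow>\<sigma>1 @ \<sigma>2. ?D B \<sigma>)" for B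
      proof -
        have "?D B \<rho> = set_det (V \<times> {..<n}) (tensor_kernel (carrier G) h B \<tau>)"
          unfolding \<tau>_def n_def[symmetric]
          by (rule set_det_tensor_kernel_conj[symmetric]) (use \<rho> P Q h V assms(3) in auto)
        also have "\<dots> = ?D B ?\<tau>1 * ?D B ?\<tau>2"
          unfolding n split(2,4) by (rule split(6)[OF V h])
        finally show ?thesis using \<sigma>1(3) \<sigma>2(3) by simp
      qed
      ultimately show ?thesis
        using \<sigma>1(1) \<sigma>2(1) by (intro exI[of _ "\<sigma>1 @ \<sigma>2"]) auto
    qed
  qed
  then show thesis using that by blast
qed

section \<open>Schur's lemma and orthogonality of characters\<close>

lemma equivalent_repsI:
  assumes "rep_dim G \<rho> = n" "rep_dim G \<sigma> = n" "T \<in> carrier_mat n n" "S \<in> carrier_mat n n"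
    "T * S = 1\<^sub>m n" "S * T = 1\<^sub>m n" "\<And>x. x \<in> carrier G \<Longrightarrow> T * \<rho> x = \<sigma> x * T"
  shows "equivalent_reps G \<rho> \<sigma>"
proof -
  have "inverts_mat T S" "inverts_mat S T" "square_mat T"
    using assms(3-6) by (simp_all add: inverts_mat_def)
  then have inv: "invertible_mat T" unfolding invertible_mat_def by blast
  show ?thesis
    unfolding equivalent_reps_def assms(1,2)
    by (intro conjI bexI[of _ T] ballI refl inv assms(3,7))
qed

lemma equivalent_repsE:
  fixes \<rho> :: "'g \<Rightarrow> 'k::field mat"
  assumes eq: "equivalent_reps G \<rho> \<sigma>" and \<rho>: "representation G \<rho>" and \<sigma>: "representation G \<sigma>"
  obtains P Q where "P \<in> carrier_mat (rep_dim G \<rho>) (rep_dim G \<rho>)"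
    "Q \<in> carrier_mat (rep_dim G \<rho>) (rep_dim G \<rho>)"
    "P * Q = 1\<^sub>m (rep_dim G \<rho>)" "Q * P = 1\<^sub>m (rep_dim G \<rho>)"
    "\<And>x. x \<in> carrier G \<Longrightarrow> \<sigma> x = P * \<rho> x * Q" "rep_dim G \<sigma> = rep_dim G \<rho>"
proof -
  define n where "n = rep_dim G \<rho>"
  obtain T where T: "T \<in> carrier_mat n n" "invertible_mat T"
      "\<And>x. x \<in> carrier G \<Longrightarrow> T * \<rho> x = \<sigma> x * T"
    using eq unfolding equivalent_reps_def n_def by metis
  have dim: "rep_dim G \<sigma> = n"
    using eq unfolding equivalent_reps_def n_def by metis
  obtain S where "inverts_mat T S" "inverts_mat S T"
    using T(2) unfolding invertible_mat_def by blast
  then have S: "T * S = 1\<^sub>m n" "S * T = 1\<^sub>m (dim_row S)"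
    using T(1) by (simp_all add: inverts_mat_def)
  \<comment> \<open>\<open>inverts_mat\<close> does not fix the shape of \<open>S\<close>; it is
    recovered from the two products being identity matrices.\<close>
  have "dim_col S = n" using arg_cong[OF S(1), of dim_col] by simp
  moreover have "dim_row S = n" using arg_cong[OF S(2), of dim_col] T(1) by simp
  ultimately have S': "S \<in> carrier_mat n n" "S * T = 1\<^sub>m n" using S by auto
  have "\<sigma> x = T * \<rho> x * S" if x: "x \<in> carrier G" for x
  proof -
    have \<sigma>x: "\<sigma> x \<in> carrier_mat n n" using representationD(1)[OF \<sigma> x] dim by simp
    have "T * \<rho> x * S = \<sigma> x * (T * S)"
      unfolding T(3)[OF x] using \<sigma>x T S' by (simp only: assoc_mult_mat[of _ n n _ n _ n])
    then show ?thesis using S(1) \<sigma>x by simp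
  qed
  then show thesis
    using that T(1) S(1) S' dim unfolding n_def by blast
qed

lemma mult_mat_vec_unit_vec:
  "A \<in> carrier_mat n m \<Longrightarrow> j < m \<Longrightarrow> A *\<^sub>v unit_vec m j = col (A :: 'k::comm_ring_1 mat) j"
  by (intro eq_vecI) auto

text \<open>The kernel and the image of \<open>T\<close> are invariant subspaces. As
  \<open>T\<close> is not zero, irreducibility forces the kernel to be zero and the image to be the
  whole space. The dimensions \<open>m\<close> and \<open>n\<close> are compared only at the end,
  once a two-sided inverse is known.\<close>

lemma schur_equivalent:
  fixes \<rho> :: "'g \<Rightarrow> 'k::field_char_0 mat"
  assumes \<rho>: "irreducible_rep G \<rho>" "rep_dim G \<rho> = m" and \<sigma>: "irreducible_rep G \<sigma>" "rep_dim G \<sigma> = n"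
    and T: "T \<in> carrier_mat n m" and comm: "\<And>x. x \<in> carrier G \<Longrightarrow> \<sigma> x * T = T * \<rho> x"
    and nz: "T \<noteq> 0\<^sub>m n m"
  shows "equivalent_reps G \<rho> \<sigma>"
proof -
  note \<rho>' = representationD[OF irreducible_repD(1)[OF \<rho>(1)], unfolded \<rho>(2)]
  note \<sigma>' = representationD[OF irreducible_repD(1)[OF \<sigma>(1)], unfolded \<sigma>(2)]
  define W where "W = {u \<in> carrier_vec m. T *\<^sub>v u = 0\<^sub>v n}"
  define R where "R = (\<lambda>u. T *\<^sub>v u) ` carrier_vec m"
  have nzT: "\<exists>u\<in>carrier_vec m. T *\<^sub>v u \<noteq> 0\<^sub>v n"
  proof (rule ccontr)
    assume "\<not> ?thesis"
    then have "T *\<^sub>v unit_vec m j = 0\<^sub>v n" for j by simp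
    then have "col T j = 0\<^sub>v n" if "j < m" for j
      using mult_mat_vec_unit_vec[OF T that] by metis
    then have "T = 0\<^sub>m n m"
      using T by (intro mat_col_eqI) auto
    then show False using nz by simp
  qed
  have intertwine: "T *\<^sub>v (\<rho> x *\<^sub>v u) = \<sigma> x *\<^sub>v (T *\<^sub>v u)" if "x \<in> carrier G" "u \<in> carrier_vec m" for x u
    using assoc_mult_mat_vec[OF T \<rho>'(1)[OF that(1)] that(2)]
      assoc_mult_mat_vec[OF \<sigma>'(1)[OF that(1)] T that(2)] comm[OF that(1)] by simp
  have "W = {0\<^sub>v m} \<or> W = carrier_vec m"
  proof (rule irreducible_repD(3)[OF \<rho>(1), unfolded \<rho>(2)])
    show "VectorSpace.subspace class_ring W (module_vec TYPE('k) m)"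
      using T mult_mat_zero_vec[OF T] by (auto simp: subspace_module_vec_iff W_def mult_add_distrib_mat_vec mult_mat_vec)
    fix x u assume x: "x \<in> carrier G" and u: "u \<in> W"
    then have "T *\<^sub>v (\<rho> x *\<^sub>v u) = \<sigma> x *\<^sub>v 0\<^sub>v n"
      using intertwine[OF x, of u] by (simp add: W_def)
    then show "\<rho> x *\<^sub>v u \<in> W"
      using u \<rho>'(1)[OF x] mult_mat_zero_vec[OF \<sigma>'(1)[OF x]] by (auto simp: W_def)
  qed
  then have W: "W = {0\<^sub>v m}"
    using nzT by (auto simp: W_def)
  have "R = {0\<^sub>v n} \<or> R = carrier_vec n"
  proof (rule irreducible_repD(3)[OF \<sigma>(1), unfolded \<sigma>(2)])
    have "T *\<^sub>v u + T *\<^sub>v v \<in> R" if "u \<in> carrier_vec m" "v \<in> carrier_vec m" for u v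
      using that T mult_add_distrib_mat_vec[OF T that] by (auto simp: R_def intro!: image_eqI[of _ _ "u + v"])
    moreover have "c \<cdot>\<^sub>v (T *\<^sub>v u) \<in> R" if "u \<in> carrier_vec m" for c u
      using that T mult_mat_vec[OF T that] by (auto simp: R_def intro!: image_eqI[of _ _ "c \<cdot>\<^sub>v u"])
    moreover have "0\<^sub>v n \<in> R"
      using mult_mat_zero_vec[OF T] by (auto simp: R_def intro!: image_eqI[of _ _ "0\<^sub>v m"])
    ultimately show "VectorSpace.subspace class_ring R (module_vec TYPE('k) n)"
      using T by (auto simp: subspace_module_vec_iff R_def)
    fix x u assume x: "x \<in> carrier G" and "u \<in> R"
    then obtain v where v: "v \<in> carrier_vec m" "u = T *\<^sub>v v" by (auto simp: R_def)
    have "\<sigma> x *\<^sub>v u = T *\<^sub>v (\<rho> x *\<^sub>v v)"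
      using v intertwine[OF x v(1)] by simp
    then show "\<sigma> x *\<^sub>v u \<in> R"
      using v \<rho>'(1)[OF x] by (auto simp: R_def)
  qed
  then have R: "R = carrier_vec n"
    using nzT by (auto simp: R_def)
  have "\<exists>v. v \<in> carrier_vec m \<and> T *\<^sub>v v = unit_vec n j" for j
    using R unfolding R_def by (metis (no_types, lifting) image_iff unit_vec_carrier)
  then obtain f where f: "\<And>j. f j \<in> carrier_vec m" "\<And>j. T *\<^sub>v f j = unit_vec n j" by metis
  \<comment> \<open>The columns are preimages of the unit vectors, so \<open>S\<close> is a right
    inverse of \<open>T\<close>; injectivity of \<open>T\<close> then makes it a left
    inverse.\<close>
  define S where "S = mat m n (\<lambda>(i, j). f j $ i)"
  have S: "S \<in> carrier_mat m n" by (simp add: S_def)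
  have colS: "col S j = f j" if "j < n" for j
    using that f(1)[of j] by (intro eq_vecI) (auto simp: S_def)
  have TS: "T * S = 1\<^sub>m n"
    using T S colS f(2) by (intro mat_col_eqI) (auto simp: col_mult2[of _ n m _ n])
  have ST: "S * T = 1\<^sub>m m"
  proof (rule mat_col_eqI)
    fix j assume "j < dim_col (1\<^sub>m m)"
    then have j: "j < m" by simp
    let ?u = "col (S * T) j" and ?e = "unit_vec m j :: 'k vec"
    have u: "?u \<in> carrier_vec m" using S T j by auto
    have "T *\<^sub>v ?u = T *\<^sub>v (S *\<^sub>v col T j)"
      using S T j by (simp add: col_mult2[of _ m n _ m])
    also have "\<dots> = col T j"
    proof -
      have c: "col T j \<in> carrier_vec n" using T by (intro carrier_vecI) simp
      have "1\<^sub>m n *\<^sub>v col T j = col T j" using c by simp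
      then show ?thesis by (simp only: assoc_mult_mat_vec[OF T S c, symmetric] TS)
    qed
    also have "\<dots> = T *\<^sub>v ?e" using mult_mat_vec_unit_vec[OF T j] by simp
    finally have "T *\<^sub>v (?u - ?e) = 0\<^sub>v n"
      using T u by (simp add: mult_minus_distrib_mat_vec[of _ n m])
    then have "?u - ?e \<in> W" using u by (simp add: W_def)
    then have "?u - ?e = 0\<^sub>v m" using W by simp
    then have "(?u - ?e) $ i = 0" if "i < m" for i
      using that by simp
    then have "?u $ i = ?e $ i" if "i < m" for i
      using that index_minus_vec(1)[of i ?e ?u] by simp
    then have "?u = ?e" using S by (intro eq_vecI) auto
    then show "col (S * T) j = col (1\<^sub>m m) j" using j by simp
  qed (use S T in auto)
  \<comment> \<open>comparing traces of \<open>T * S\<close> and \<open>S * T\<close> shows that \<open>T\<close> is square\<close>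
  have "of_nat n = (of_nat m :: 'k)"
    using mat_trace_mult_commute[OF T S] by (simp add: TS ST mat_trace_def)
  then have nm: "n = m" by simp
  show ?thesis
  proof (rule equivalent_repsI[of _ _ n _ T S])
    show "T * \<rho> x = \<sigma> x * T" if "x \<in> carrier G" for x by (rule comm[OF that, symmetric])
  qed (rule T[folded nm] S[folded nm] TS ST[folded nm] \<rho>(2)[folded nm] \<sigma>(2))+
qed

text \<open>An eigenvalue of \<open>T\<close> is available over the algebraic closure, where the
  splitting property keeps \<open>\<rho>\<close> irreducible. The eigenspace is invariant and
  nonzero, hence everything. The eigenvalue is then an entry of \<open>T\<close>, so it comes from
  \<open>K\<close>, and injectivity of \<open>to_ac\<close> brings the equation back.\<close>

lemma schur_scalar:
  fixes \<rho> :: "'g \<Rightarrow> 'k::field_char_0 mat"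
  assumes K: "splitting_field TYPE('k) G" and \<rho>: "irreducible_rep G \<rho>" "rep_dim G \<rho> = n"
    and T: "T \<in> carrier_mat n n" and comm: "\<And>x. x \<in> carrier G \<Longrightarrow> \<rho> x * T = T * \<rho> x"
  obtains c where "T = c \<cdot>\<^sub>m 1\<^sub>m n"
proof -
  interpret ac: inj_comm_ring_hom "to_ac :: 'k \<Rightarrow> _"
    by unfold_locales (auto simp: to_ac_add to_ac_mult)
  define \<sigma> where "\<sigma> = (\<lambda>x. map_mat to_ac (\<rho> x))"
  have \<sigma>: "irreducible_rep G \<sigma>" using K \<rho>(1) by (simp add: splitting_field_def \<sigma>_def)
  have dim: "rep_dim G \<sigma> = n" using \<rho>(2) by (simp add: \<sigma>_def rep_dim_def)
  have n: "n > 0" using irreducible_repD(2)[OF \<rho>(1)] \<rho>(2) by simp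
  note \<rho>' = representationD[OF irreducible_repD(1)[OF \<rho>(1)], unfolded \<rho>(2)]
  note \<sigma>' = representationD[OF irreducible_repD(1)[OF \<sigma>], unfolded dim]
  define T' where "T' = map_mat to_ac T"
  have T': "T' \<in> carrier_mat n n" using T by (simp add: T'_def)
  have comm': "\<sigma> x * T' = T' * \<sigma> x" if "x \<in> carrier G" for x
    unfolding \<sigma>_def T'_def
    using arg_cong[OF comm[OF that], of "map_mat to_ac"] T \<rho>'(1)[OF that]
    by (simp add: ac.mat_hom_mult[of _ n n _ n])
  have "degree (char_poly T') = n" using degree_monic_char_poly[OF T'] by simp
  then obtain c where "poly (char_poly T') c = 0"
    using n alg_closed_imp_poly_has_root[of "char_poly T'"] by auto
  then obtain v where v: "v \<in> carrier_vec n" "v \<noteq> 0\<^sub>v n" "T' *\<^sub>v v = c \<cdot>\<^sub>v v"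
    using T' eigenvalue_root_char_poly[OF T'] by (auto simp: eigenvalue_def eigenvector_def)
  define W where "W = {u \<in> carrier_vec n. T' *\<^sub>v u = c \<cdot>\<^sub>v u}"
  have "W = {0\<^sub>v n} \<or> W = carrier_vec n"
  proof (rule irreducible_repD(3)[OF \<sigma>, unfolded dim])
    show "VectorSpace.subspace class_ring W (module_vec TYPE('k alg_closure) n)"
      using T' mult_mat_zero_vec[OF T'] by (auto simp: subspace_module_vec_iff W_def mult_add_distrib_mat_vec mult_mat_vec
          smult_add_distrib_vec smult_smult_assoc mult.commute)
    fix x u assume x: "x \<in> carrier G" and u: "u \<in> W"
    then have "u \<in> carrier_vec n" by (simp add: W_def)
    then have "T' *\<^sub>v (\<sigma> x *\<^sub>v u) = \<sigma> x *\<^sub>v (T' *\<^sub>v u)"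
      using assoc_mult_mat_vec[OF T' \<sigma>'(1)[OF x], of u] assoc_mult_mat_vec[OF \<sigma>'(1)[OF x] T', of u]
        comm'[OF x] by simp
    also have "\<dots> = c \<cdot>\<^sub>v (\<sigma> x *\<^sub>v u)"
      using u \<sigma>'(1)[OF x] by (simp add: W_def mult_mat_vec)
    finally show "\<sigma> x *\<^sub>v u \<in> W"
      using u \<sigma>'(1)[OF x] by (auto simp: W_def)
  qed
  then have W: "W = carrier_vec n" using v by (auto simp: W_def)
  have entry: "T' $$ (i, j) = (if i = j then c else 0)" if "i < n" "j < n" for i j
  proof -
    have "T' *\<^sub>v unit_vec n j = c \<cdot>\<^sub>v unit_vec n j"
    proof -
      have "unit_vec n j \<in> W" by (simp add: W)
      then show ?thesis by (simp add: W_def)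
    qed
    then have "col T' j = c \<cdot>\<^sub>v unit_vec n j" using mult_mat_vec_unit_vec[OF T' that(2)] by simp
    from arg_cong[OF this, of "\<lambda>v. vec_index v i"] show ?thesis using that T' by simp
  qed
  have c: "c = to_ac (T $$ (0, 0))" using entry[of 0 0] n T by (simp add: T'_def)
  have "T = T $$ (0, 0) \<cdot>\<^sub>m 1\<^sub>m n"
  proof (rule eq_matI)
    fix i j assume "i < dim_row (T $$ (0, 0) \<cdot>\<^sub>m 1\<^sub>m n)" "j < dim_col (T $$ (0, 0) \<cdot>\<^sub>m 1\<^sub>m n)"
    then have ij: "i < n" "j < n" by auto
    have "to_ac (T $$ (i, j)) = to_ac (if i = j then T $$ (0, 0) else 0)"
      using entry[OF ij] ij T by (simp add: T'_def c)
    then have "T $$ (i, j) = (if i = j then T $$ (0, 0) else 0)"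
      by (rule to_ac_eq_iff[THEN iffD1])
    also have "\<dots> = (T $$ (0, 0) \<cdot>\<^sub>m 1\<^sub>m n) $$ (i, j)"
      using ij by simp
    finally show "T $$ (i, j) = (T $$ (0, 0) \<cdot>\<^sub>m 1\<^sub>m n) $$ (i, j)" .
  qed (use T in auto)
  then show thesis by (rule that)
qed

text \<open>Averaging matrix units over \<open>G\<close> yields intertwiners, to which Schur's lemma
  applies: they vanish between inequivalent representations and are scalars from
  \<open>\<rho>\<close> to itself. The sum of products of traces is a sum of entries of such
  averages.\<close>

lemma character_orthogonality:
  fixes \<rho> :: "'g \<Rightarrow> 'k::field_char_0 mat"
  assumes K: "splitting_field TYPE('k) G" and G: "group G" "finite (carrier G)"
    and \<rho>: "irreducible_rep G \<rho>" and \<sigma>: "irreducible_rep G \<sigma>"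
  shows "(\<Sum>x\<in>carrier G. mat_trace (\<sigma> x) * mat_trace (\<rho> (inv\<^bsub>G\<^esub> x)))
    = (if equivalent_reps G \<rho> \<sigma> then of_nat (card (carrier G)) else 0)"
proof -
  interpret G: group G by fact
  \<comment> \<open>\<open>T \<sigma> p q\<close> is the sum over \<open>x\<close> of
    \<open>\<sigma> x * E * \<rho> (x^-1)\<close>, with \<open>E\<close> the matrix unit at
    \<open>(p, q)\<close>. The argument \<open>\<sigma>\<close> stays free because
    \<open>\<rho>\<close> itself is substituted for it in the equivalent case.\<close>
  define T where "T = (\<lambda>(\<sigma> :: 'g \<Rightarrow> 'k mat) p q. mat (rep_dim G \<sigma>) (rep_dim G \<rho>)
    (\<lambda>(i, j). \<Sum>x\<in>carrier G. \<sigma> x $$ (i, p) * \<rho> (inv\<^bsub>G\<^esub> x) $$ (q, j)))"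
  have T: "T \<sigma> p q \<in> carrier_mat (rep_dim G \<sigma>) (rep_dim G \<rho>)" for \<sigma> p q by (simp add: T_def)
  note R\<rho> = representationD[OF irreducible_repD(1)[OF \<rho>]]
  have T_comm: "\<sigma> y * T \<sigma> p q = T \<sigma> p q * \<rho> y"
    if \<sigma>: "irreducible_rep G \<sigma>" and y: "y \<in> carrier G" and p: "p < rep_dim G \<sigma>" and q: "q < rep_dim G \<rho>"
    for \<sigma> y p q
  proof (rule eq_matI)
    note R\<sigma> = representationD[OF irreducible_repD(1)[OF \<sigma>]]
    let ?n = "rep_dim G \<sigma>" and ?m = "rep_dim G \<rho>"
    fix i j assume "i < dim_row (T \<sigma> p q * \<rho> y)" "j < dim_col (T \<sigma> p q * \<rho> y)"
    then have ij: "i < ?n" "j < ?m" using R\<rho>(1)[OF y] by (auto simp: T_def)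
    have "(\<sigma> y * T \<sigma> p q) $$ (i, j)
        = (\<Sum>k<?n. \<sigma> y $$ (i, k) * (\<Sum>x\<in>carrier G. \<sigma> x $$ (k, p) * \<rho> (inv\<^bsub>G\<^esub> x) $$ (q, j)))"
      using ij by (subst mult_mat_entry[OF R\<sigma>(1)[OF y] T]) (simp_all add: T_def)
    also have "\<dots> = (\<Sum>x\<in>carrier G. (\<Sum>k<?n. \<sigma> y $$ (i, k) * \<sigma> x $$ (k, p)) * \<rho> (inv\<^bsub>G\<^esub> x) $$ (q, j))"
      unfolding sum_distrib_left sum_distrib_right by (subst sum.swap) (simp add: mult.assoc)
    also have "\<dots> = (\<Sum>x\<in>carrier G. \<sigma> (y \<otimes>\<^bsub>G\<^esub> x) $$ (i, p) * \<rho> (inv\<^bsub>G\<^esub> (y \<otimes>\<^bsub>G\<^esub> x) \<otimes>\<^bsub>G\<^esub> y) $$ (q, j))"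
    proof (rule sum.cong)
      fix x assume x: "x \<in> carrier G"
      have "inv\<^bsub>G\<^esub> (y \<otimes>\<^bsub>G\<^esub> x) \<otimes>\<^bsub>G\<^esub> y = inv\<^bsub>G\<^esub> x"
        using x y by (simp add: G.inv_mult_group G.m_assoc)
      then show "(\<Sum>k<?n. \<sigma> y $$ (i, k) * \<sigma> x $$ (k, p)) * \<rho> (inv\<^bsub>G\<^esub> x) $$ (q, j)
          = \<sigma> (y \<otimes>\<^bsub>G\<^esub> x) $$ (i, p) * \<rho> (inv\<^bsub>G\<^esub> (y \<otimes>\<^bsub>G\<^esub> x) \<otimes>\<^bsub>G\<^esub> y) $$ (q, j)"
        using ij p by (simp only: R\<sigma>(3)[OF y x] mult_mat_entry[OF R\<sigma>(1)[OF y] R\<sigma>(1)[OF x]])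
    qed simp
    \<comment> \<open>Substituting \<open>x\<close> for \<open>y \<otimes> x\<close> carries
      \<open>y\<close> from the left factor to the right one.\<close>
    also have "\<dots> = (\<Sum>x\<in>carrier G. \<sigma> x $$ (i, p) * \<rho> (inv\<^bsub>G\<^esub> x \<otimes>\<^bsub>G\<^esub> y) $$ (q, j))"
      using y by (intro sum.reindex_bij_witness[of _ "\<lambda>x. inv\<^bsub>G\<^esub> y \<otimes>\<^bsub>G\<^esub> x" "\<lambda>x. y \<otimes>\<^bsub>G\<^esub> x"])
        (auto simp: G.m_assoc[symmetric])
    also have "\<dots> = (\<Sum>x\<in>carrier G. \<sigma> x $$ (i, p) * (\<Sum>k<?m. \<rho> (inv\<^bsub>G\<^esub> x) $$ (q, k) * \<rho> y $$ (k, j)))"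
      using ij q y by (intro sum.cong refl) (simp only: R\<rho>(3)[OF G.inv_closed y]
          mult_mat_entry[OF R\<rho>(1)[OF G.inv_closed] R\<rho>(1)[OF y]])
    also have "\<dots> = (\<Sum>k<?m. (\<Sum>x\<in>carrier G. \<sigma> x $$ (i, p) * \<rho> (inv\<^bsub>G\<^esub> x) $$ (q, k)) * \<rho> y $$ (k, j))"
      unfolding sum_distrib_left sum_distrib_right by (subst sum.swap) (simp add: mult.assoc)
    also have "\<dots> = (T \<sigma> p q * \<rho> y) $$ (i, j)"
      using ij by (subst mult_mat_entry[OF T R\<rho>(1)[OF y]]) (simp_all add: T_def)
    finally show "(\<sigma> y * T \<sigma> p q) $$ (i, j) = (T \<sigma> p q * \<rho> y) $$ (i, j)" .
  qed (use R\<rho>(1)[OF y] representationD(1)[OF irreducible_repD(1)[OF \<sigma>] y] in \<open>auto simp: T_def\<close>)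
  have sum_eq: "(\<Sum>x\<in>carrier G. mat_trace (\<sigma> x) * mat_trace (\<rho> (inv\<^bsub>G\<^esub> x)))
      = (\<Sum>i<rep_dim G \<sigma>. \<Sum>j<rep_dim G \<rho>. T \<sigma> i j $$ (i, j))"
    if \<sigma>: "irreducible_rep G \<sigma>" for \<sigma>
  proof -
    note R\<sigma> = representationD[OF irreducible_repD(1)[OF \<sigma>]]
    have "(\<Sum>x\<in>carrier G. mat_trace (\<sigma> x) * mat_trace (\<rho> (inv\<^bsub>G\<^esub> x)))
        = (\<Sum>x\<in>carrier G. \<Sum>i<rep_dim G \<sigma>. \<Sum>j<rep_dim G \<rho>. \<sigma> x $$ (i, i) * \<rho> (inv\<^bsub>G\<^esub> x) $$ (j, j))"
    proof (rule sum.cong)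
      fix x assume x: "x \<in> carrier G"
      have "dim_row (\<sigma> x) = rep_dim G \<sigma>" "dim_row (\<rho> (inv\<^bsub>G\<^esub> x)) = rep_dim G \<rho>"
        using R\<sigma>(1)[OF x] R\<rho>(1)[OF G.inv_closed[OF x]] by auto
      then show "mat_trace (\<sigma> x) * mat_trace (\<rho> (inv\<^bsub>G\<^esub> x))
          = (\<Sum>i<rep_dim G \<sigma>. \<Sum>j<rep_dim G \<rho>. \<sigma> x $$ (i, i) * \<rho> (inv\<^bsub>G\<^esub> x) $$ (j, j))"
        by (simp add: mat_trace_def sum_product)
    qed simp
    also have "\<dots> = (\<Sum>i<rep_dim G \<sigma>. \<Sum>x\<in>carrier G. \<Sum>j<rep_dim G \<rho>. \<sigma> x $$ (i, i) * \<rho> (inv\<^bsub>G\<^esub> x) $$ (j, j))"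
      by (rule sum.swap)
    also have "\<dots> = (\<Sum>i<rep_dim G \<sigma>. \<Sum>j<rep_dim G \<rho>. \<Sum>x\<in>carrier G. \<sigma> x $$ (i, i) * \<rho> (inv\<^bsub>G\<^esub> x) $$ (j, j))"
      by (intro sum.cong refl sum.swap)
    finally show ?thesis by (simp add: T_def)
  qed
  show ?thesis
  proof (cases "equivalent_reps G \<rho> \<sigma>")
    case False
    have "T \<sigma> i j = 0\<^sub>m (rep_dim G \<sigma>) (rep_dim G \<rho>)" if "i < rep_dim G \<sigma>" "j < rep_dim G \<rho>" for i j
      using schur_equivalent[OF \<rho> refl \<sigma> refl T T_comm[OF \<sigma>]] that False by blast
    then show ?thesis using False by (simp add: sum_eq[OF \<sigma>])
  next
    case True
    define n where "n = rep_dim G \<rho>"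
    have n: "n > 0" using irreducible_repD(2)[OF \<rho>] by (simp add: n_def)
    obtain P Q where PQ: "P \<in> carrier_mat n n" "Q \<in> carrier_mat n n" "Q * P = 1\<^sub>m n"
      "\<And>x. x \<in> carrier G \<Longrightarrow> \<sigma> x = P * \<rho> x * Q"
      using equivalent_repsE[OF True irreducible_repD(1)[OF \<rho>] irreducible_repD(1)[OF \<sigma>]]
      unfolding n_def by metis
    \<comment> \<open>Traces are invariant under conjugation, so \<open>\<sigma>\<close> may be
      replaced by \<open>\<rho>\<close>, for which the averages are scalar matrices.\<close>
    have "mat_trace (\<sigma> x) = mat_trace (\<rho> x)" if x: "x \<in> carrier G" for x
    proof -
      have \<rho>x: "\<rho> x \<in> carrier_mat n n" using R\<rho>(1)[OF x] by (simp add: n_def)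
      have "mat_trace (\<sigma> x) = mat_trace (Q * (P * \<rho> x))"
        unfolding PQ(4)[OF x] using PQ \<rho>x by (intro mat_trace_mult_commute[of _ n n]) auto
      also have "Q * (P * \<rho> x) = \<rho> x"
        using assoc_mult_mat[OF PQ(2,1) \<rho>x] \<rho>x by (simp add: PQ(3))
      finally show ?thesis .
    qed
    then have "(\<Sum>x\<in>carrier G. mat_trace (\<sigma> x) * mat_trace (\<rho> (inv\<^bsub>G\<^esub> x)))
        = (\<Sum>x\<in>carrier G. mat_trace (\<rho> x) * mat_trace (\<rho> (inv\<^bsub>G\<^esub> x)))" by simp
    also have "\<dots> = (\<Sum>i<n. \<Sum>j<n. T \<rho> i j $$ (i, j))"
      using sum_eq[OF \<rho>] by (simp add: n_def)
    also have "\<dots> = of_nat (card (carrier G))"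
    proof -
      have "\<exists>c. T \<rho> p q = c \<cdot>\<^sub>m 1\<^sub>m n" if "p < n" "q < n" for p q
        using schur_scalar[OF K \<rho> n_def[symmetric], of "T \<rho> p q"] T T_comm[OF \<rho>] that
        unfolding n_def by metis
      then obtain c where c: "\<And>p q. p < n \<Longrightarrow> q < n \<Longrightarrow> T \<rho> p q = c p q \<cdot>\<^sub>m 1\<^sub>m n" by metis
      \<comment> \<open>The scalar is found from the trace of \<open>T \<rho> p p\<close>: each
        \<open>x\<close> contributes the entry at \<open>(p, p)\<close> of
        \<open>\<rho> (x^-1 x)\<close>, which is 1.\<close>
      have nc: "of_nat n * c p p = of_nat (card (carrier G))" if p: "p < n" for p
      proof -
        have "of_nat n * c p p = mat_trace (T \<rho> p p)"
          using c[OF p p] by (simp add: mat_trace_def)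
        also have "\<dots> = (\<Sum>i<n. \<Sum>x\<in>carrier G. \<rho> (inv\<^bsub>G\<^esub> x) $$ (p, i) * \<rho> x $$ (i, p))"
          by (simp add: mat_trace_def T_def n_def mult.commute)
        also have "\<dots> = (\<Sum>x\<in>carrier G. \<Sum>i<n. \<rho> (inv\<^bsub>G\<^esub> x) $$ (p, i) * \<rho> x $$ (i, p))"
          by (rule sum.swap)
        also have "\<dots> = (\<Sum>x\<in>carrier G. 1)"
        proof (rule sum.cong)
          fix x assume x: "x \<in> carrier G"
          have "(\<Sum>i<n. \<rho> (inv\<^bsub>G\<^esub> x) $$ (p, i) * \<rho> x $$ (i, p)) = \<rho> (inv\<^bsub>G\<^esub> x \<otimes>\<^bsub>G\<^esub> x) $$ (p, p)"
            using p unfolding n_def R\<rho>(3)[OF G.inv_closed[OF x] x]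
            by (subst mult_mat_entry[OF R\<rho>(1)[OF G.inv_closed[OF x]] R\<rho>(1)[OF x]]) auto
          then show "(\<Sum>i<n. \<rho> (inv\<^bsub>G\<^esub> x) $$ (p, i) * \<rho> x $$ (i, p)) = 1"
            using p x by (simp add: R\<rho>(2) n_def)
        qed simp
        finally show ?thesis by simp
      qed
      \<comment> \<open>A scalar matrix \<open>T \<rho> i j\<close> has a zero at
        \<open>(i, j)\<close> unless \<open>i = j\<close>. The factor \<open>n\<close> matches the
        form of \<open>nc\<close>; it is nonzero in characteristic 0 and cancels at the end.\<close>
      have "of_nat n * (\<Sum>i<n. \<Sum>j<n. T \<rho> i j $$ (i, j)) = of_nat n * (\<Sum>i<n. c i i)"
      proof -
        have "(\<Sum>j<n. T \<rho> i j $$ (i, j)) = (\<Sum>j<n. if i = j then c i j else 0)" if "i < n" for i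
          using that by (intro sum.cong) (auto simp: c)
        then show ?thesis by simp
      qed
      also have "\<dots> = of_nat n * of_nat (card (carrier G))"
        by (simp add: sum_distrib_left nc)
      finally show ?thesis using n by simp
    qed
    finally show ?thesis using True by simp
  qed
qed

section \<open>The determinant of a matrix over the group algebra\<close>

lemma equiv_equivalent_reps:
  "equiv {\<rho> :: 'g \<Rightarrow> 'k::field mat. irreducible_rep G \<rho>}
     {(\<rho>, \<sigma>). irreducible_rep G \<rho> \<and> irreducible_rep G \<sigma> \<and> equivalent_reps G \<rho> \<sigma>}"
    (is "equiv ?A ?R")
proof (rule equivI)
  show "?R \<subseteq> ?A \<times> ?A" by auto
  show "refl_on ?A ?R"
  proof (rule refl_onI)
    fix \<rho> :: "'g \<Rightarrow> 'k mat" assume "\<rho> \<in> ?A"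
    then have \<rho>: "irreducible_rep G \<rho>" by simp
    let ?I = "1\<^sub>m (rep_dim G \<rho>) :: 'k mat"
    have "equivalent_reps G \<rho> \<rho>"
    proof (rule equivalent_repsI[of _ _ _ _ ?I ?I])
      fix x assume x: "x \<in> carrier G"
      show "?I * \<rho> x = \<rho> x * ?I"
        using representationD(1)[OF irreducible_repD(1)[OF \<rho>] x] by simp
    qed simp_all
    with \<rho> show "(\<rho>, \<rho>) \<in> ?R" by simp
  qed
  show "sym ?R"
  proof (rule symI)
    fix \<rho> \<sigma> :: "'g \<Rightarrow> 'k mat" assume "(\<rho>, \<sigma>) \<in> ?R"
    then have *: "irreducible_rep G \<rho>" "irreducible_rep G \<sigma>" "equivalent_reps G \<rho> \<sigma>" by auto
    let ?n = "rep_dim G \<rho>"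
    obtain P Q where PQ: "P \<in> carrier_mat ?n ?n" "Q \<in> carrier_mat ?n ?n" "P * Q = 1\<^sub>m ?n" "Q * P = 1\<^sub>m ?n"
      "\<And>x. x \<in> carrier G \<Longrightarrow> \<sigma> x = P * \<rho> x * Q" and dim: "rep_dim G \<sigma> = ?n"
      using equivalent_repsE[OF *(3) irreducible_repD(1)[OF *(1)] irreducible_repD(1)[OF *(2)]] by blast
    have "Q * \<sigma> x = \<rho> x * Q" if x: "x \<in> carrier G" for x
    proof -
      have \<rho>x: "\<rho> x \<in> carrier_mat ?n ?n" by (rule representationD(1)[OF irreducible_repD(1)[OF *(1)] x])
      have "Q * \<sigma> x = Q * P * (\<rho> x * Q)"
        unfolding PQ(5)[OF x] assoc_mult_mat[OF PQ(1) \<rho>x PQ(2)]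
        by (rule assoc_mult_mat[OF PQ(2,1) mult_carrier_mat[OF \<rho>x PQ(2)], symmetric])
      then show ?thesis using \<rho>x PQ(2) by (simp add: PQ(4))
    qed
    then have "equivalent_reps G \<sigma> \<rho>"
      by (intro equivalent_repsI[OF dim refl PQ(2,1,4,3)])
    with * show "(\<sigma>, \<rho>) \<in> ?R" by simp
  qed
  show "trans ?R"
  proof (rule transI)
    fix \<rho> \<sigma> \<tau> :: "'g \<Rightarrow> 'k mat" assume "(\<rho>, \<sigma>) \<in> ?R" "(\<sigma>, \<tau>) \<in> ?R"
    then have *: "irreducible_rep G \<rho>" "irreducible_rep G \<sigma>" "irreducible_rep G \<tau>"
      "equivalent_reps G \<rho> \<sigma>" "equivalent_reps G \<sigma> \<tau>" by auto
    let ?n = "rep_dim G \<rho>"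
    obtain P Q where PQ: "P \<in> carrier_mat ?n ?n" "Q \<in> carrier_mat ?n ?n" "P * Q = 1\<^sub>m ?n" "Q * P = 1\<^sub>m ?n"
      "\<And>x. x \<in> carrier G \<Longrightarrow> \<sigma> x = P * \<rho> x * Q" and dim: "rep_dim G \<sigma> = ?n"
      using equivalent_repsE[OF *(4) irreducible_repD(1)[OF *(1)] irreducible_repD(1)[OF *(2)]] by blast
    obtain P' Q' where PQ': "P' \<in> carrier_mat ?n ?n" "Q' \<in> carrier_mat ?n ?n" "P' * Q' = 1\<^sub>m ?n" "Q' * P' = 1\<^sub>m ?n"
      "\<And>x. x \<in> carrier G \<Longrightarrow> \<tau> x = P' * \<sigma> x * Q'" and dim': "rep_dim G \<tau> = ?n"
      using equivalent_repsE[OF *(5) irreducible_repD(1)[OF *(2)] irreducible_repD(1)[OF *(3)]]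
      unfolding dim by blast
    note carr = PQ(1,2) PQ'(1,2)
    have inv: "P' * P * (Q * Q') = 1\<^sub>m ?n" "Q * Q' * (P' * P) = 1\<^sub>m ?n"
    proof -
      have "P' * P * (Q * Q') = P' * (P * (Q * Q'))"
        by (rule assoc_mult_mat[OF carr(3,1) mult_carrier_mat[OF carr(2,4)]])
      also have "P * (Q * Q') = P * Q * Q'"
        by (rule assoc_mult_mat[OF carr(1,2,4), symmetric])
      also have "\<dots> = Q'" unfolding PQ(3) by (rule left_mult_one_mat[OF carr(4)])
      finally show "P' * P * (Q * Q') = 1\<^sub>m ?n" unfolding PQ'(3) .
      then show "Q * Q' * (P' * P) = 1\<^sub>m ?n"
        by (rule mat_mult_left_right_inverse[OF mult_carrier_mat[OF carr(3,1)] mult_carrier_mat[OF carr(2,4)]])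
    qed
    have "P' * P * \<rho> x = \<tau> x * (P' * P)" if x: "x \<in> carrier G" for x
    proof -
      have \<rho>x: "\<rho> x \<in> carrier_mat ?n ?n" by (rule representationD(1)[OF irreducible_repD(1)[OF *(1)] x])
      have "\<tau> x = P' * P * \<rho> x * (Q * Q')"
        unfolding PQ'(5)[OF x] PQ(5)[OF x]
        using carr \<rho>x by (simp add: assoc_mult_mat[of _ ?n ?n _ ?n _ ?n])
      then have "\<tau> x * (P' * P) = P' * P * \<rho> x * (Q * Q') * (P' * P)" by simp
      also have "\<dots> = P' * P * \<rho> x * (Q * Q' * (P' * P))"
        using carr \<rho>x by (intro assoc_mult_mat[of _ ?n ?n _ ?n _ ?n]) simp_all
      also have "\<dots> = P' * P * \<rho> x"
        unfolding inv(2) using carr \<rho>x by (intro right_mult_one_mat[of _ ?n]) simp_all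
      finally show ?thesis ..
    qed
    then have "equivalent_reps G \<rho> \<tau>"
      by (intro equivalent_repsI[OF refl dim' _ _ inv] mult_carrier_mat[OF carr(3,1)] mult_carrier_mat[OF carr(2,4)])
    with * show "(\<rho>, \<tau>) \<in> ?R" by simp
  qed
qed

text \<open>Right translations, written so that row \<open>i\<close> of \<open>\<rho> x\<close> has
  its 1 in the column of \<open>g i \<otimes> x\<close>; this makes \<open>\<rho>\<close>
  multiplicative in the given order. Only \<open>x = (g i)^-1 (g j)\<close> contributes to the entry
  \<open>(i, j)\<close>, which explains the argument of \<open>B\<close>, and a translation by
  \<open>x\<close> different from the identity fixes no point, which gives the trace.\<close>

lemma regular_representation:
  fixes h :: "'k::field \<Rightarrow> 'r::comm_ring_1"
  assumes G: "group G" "finite (carrier G)" and V: "finite (V :: 'v set)" and h: "comm_ring_hom h"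
  obtains \<rho> :: "'g \<Rightarrow> 'k mat" where "representation G \<rho>"
    "\<And>x. x \<in> carrier G \<Longrightarrow> mat_trace (\<rho> x) = (if x = \<one>\<^bsub>G\<^esub> then of_nat (card (carrier G)) else 0)"
    "\<And>B. set_det (V \<times> {..<rep_dim G \<rho>}) (tensor_kernel (carrier G) h B \<rho>)
      = set_det (V \<times> carrier G) (\<lambda>a b. B (inv\<^bsub>G\<^esub> (snd a) \<otimes>\<^bsub>G\<^esub> snd b) (fst a) (fst b))"
proof -
  interpret G: group G by fact
  define N where "N = card (carrier G)"
  obtain g where g: "bij_betw g {..<N} (carrier G)"
    using finite_enumeration[OF G(2)] by (auto simp: N_def)
  have gG: "g i \<in> carrier G" if "i < N" for i using g that by (auto simp: bij_betw_def)
  have g_eq: "g i = g j \<longleftrightarrow> i = j" if "i < N" "j < N" for i j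
    using g that by (auto simp: bij_betw_def inj_on_def)
  define \<rho> where "\<rho> = (\<lambda>x. mat N N (\<lambda>(i, j). if g i \<otimes>\<^bsub>G\<^esub> x = g j then 1 else 0 :: 'k))"
  have one: "\<rho> \<one>\<^bsub>G\<^esub> = 1\<^sub>m N"
    by (rule eq_matI) (auto simp: \<rho>_def gG g_eq)
  have mult: "\<rho> (x \<otimes>\<^bsub>G\<^esub> y) = \<rho> x * \<rho> y" if x: "x \<in> carrier G" and y: "y \<in> carrier G" for x y
  proof (rule eq_matI)
    fix i j assume "i < dim_row (\<rho> x * \<rho> y)" "j < dim_col (\<rho> x * \<rho> y)"
    then have ij: "i < N" "j < N" by (auto simp: \<rho>_def)
    have "(\<rho> x * \<rho> y) $$ (i, j) = (\<Sum>k<N. (if g i \<otimes>\<^bsub>G\<^esub> x = g k then 1 else 0) * (if g k \<otimes>\<^bsub>G\<^esub> y = g j then 1 else 0))"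
      using ij by (subst mult_mat_entry[of _ N N _ N]) (auto simp: \<rho>_def)
    also have "\<dots> = (\<Sum>z\<in>carrier G. (if g i \<otimes>\<^bsub>G\<^esub> x = z then 1 else 0) * (if z \<otimes>\<^bsub>G\<^esub> y = g j then 1 else 0))"
      by (rule sum.reindex_bij_betw[OF g])
    also have "\<dots> = (\<Sum>z\<in>carrier G. if g i \<otimes>\<^bsub>G\<^esub> x = z then if z \<otimes>\<^bsub>G\<^esub> y = g j then 1 else 0 else 0)"
      by (intro sum.cong) auto
    also have "\<dots> = \<rho> (x \<otimes>\<^bsub>G\<^esub> y) $$ (i, j)"
      using ij x y gG G(2) by (simp add: \<rho>_def G.m_assoc)
    finally show "\<rho> (x \<otimes>\<^bsub>G\<^esub> y) $$ (i, j) = (\<rho> x * \<rho> y) $$ (i, j)" ..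
  qed (auto simp: \<rho>_def)
  have carr: "\<rho> x \<in> carrier_mat N N" for x by (simp add: \<rho>_def)
  have rep: "representation G \<rho>" "rep_dim G \<rho> = N"
    by (rule representationI[of G \<rho> N], rule carr, rule one, erule (1) mult)+
  show thesis
  proof (rule that[OF rep(1)])
    fix x assume x: "x \<in> carrier G"
    have "g i \<otimes>\<^bsub>G\<^esub> x = g i \<longleftrightarrow> x = \<one>\<^bsub>G\<^esub>" if "i < N" for i
      using gG[OF that] x by (metis G.l_cancel_one)
    then show "mat_trace (\<rho> x) = (if x = \<one>\<^bsub>G\<^esub> then of_nat (card (carrier G)) else 0)"
      by (simp add: mat_trace_def \<rho>_def N_def)
  next
    fix B :: "'g \<Rightarrow> 'v \<Rightarrow> 'v \<Rightarrow> 'r"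
    interpret h: comm_ring_hom h by (rule h)
    let ?F = "\<lambda>a b. B (inv\<^bsub>G\<^esub> (snd a) \<otimes>\<^bsub>G\<^esub> snd b) (fst a) (fst b)"
    have bij: "bij_betw (map_prod id g) (V \<times> {..<N}) (V \<times> carrier G)"
      using g by (intro bij_betw_map_prod) auto
    have "tensor_kernel (carrier G) h B \<rho> a b = ?F (map_prod id g a) (map_prod id g b)"
      if "a \<in> V \<times> {..<N}" "b \<in> V \<times> {..<N}" for a b
    proof -
      obtain u i v j where ab: "a = (u, i)" "b = (v, j)" by (cases a, cases b)
      have ij: "i < N" "j < N" using that by (auto simp: ab)
      have "tensor_kernel (carrier G) h B \<rho> a b
          = (\<Sum>x\<in>carrier G. if x = inv\<^bsub>G\<^esub> (g i) \<otimes>\<^bsub>G\<^esub> g j then B x u v else 0)"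
        unfolding tensor_kernel_def
      proof (rule sum.cong)
        fix x assume x: "x \<in> carrier G"
        have "g i \<otimes>\<^bsub>G\<^esub> x = g j \<longleftrightarrow> x = inv\<^bsub>G\<^esub> (g i) \<otimes>\<^bsub>G\<^esub> g j"
          using x gG[OF ij(1)] gG[OF ij(2)] by (metis G.inv_solve_left)
        then show "B x (fst a) (fst b) * h (\<rho> x $$ (snd a, snd b))
            = (if x = inv\<^bsub>G\<^esub> (g i) \<otimes>\<^bsub>G\<^esub> g j then B x u v else 0)"
          using ij by (simp add: ab \<rho>_def)
      qed simp
      then show ?thesis using G(2) gG ij by (simp add: ab)
    qed
    then show "set_det (V \<times> {..<rep_dim G \<rho>}) (tensor_kernel (carrier G) h B \<rho>) = set_det (V \<times> carrier G) ?F"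
      unfolding rep(2) using V by (subst set_det_reindex[OF _ bij]) (auto intro!: set_det_cong)
  qed
qed

lemma prod_list_eq_prod_count:
  fixes f :: "'a \<Rightarrow> 'b::comm_monoid_mult"
  assumes "finite C" "set xs \<subseteq> C"
  shows "prod_list (map f xs) = (\<Prod>c\<in>C. f c ^ count_list xs c)"
  using assms(2)
proof (induction xs)
  case (Cons x xs)
  have "(\<Prod>c\<in>C. f c ^ count_list (x # xs) c) = (\<Prod>c\<in>C. (if x = c then f c else 1) * f c ^ count_list xs c)"
    by (intro prod.cong) auto
  also have "\<dots> = f x * (\<Prod>c\<in>C. f c ^ count_list xs c)"
    using Cons.prems assms(1) by (simp add: prod.distrib)
  finally show ?case using Cons by simp
qed simp

text \<open>For a one-point \<open>V\<close> the third claim is Frobenius's factorization of the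
  group determinant. The composition factors of the regular representation are collected by
  equivalence class, and the exponents are their multiplicities.\<close>

theorem group_algebra_determinant:
  fixes rep :: "('g \<Rightarrow> 'k::field_char_0 mat) set \<Rightarrow> 'g \<Rightarrow> 'k mat" and h :: "'k \<Rightarrow> 'r::idom"
  assumes G: "group G" "finite (carrier G)" and K: "splitting_field TYPE('k) G"
    and rep: "\<forall>c\<in>irr_classes G. rep c \<in> c"
    and V: "finite (V :: 'v set)" and h: "comm_ring_hom h"
  shows "finite (irr_classes G :: ('g \<Rightarrow> 'k mat) set set)"
    and "c \<in> irr_classes G \<Longrightarrow> irreducible_rep G (rep c)"
    and "set_det (V \<times> carrier G) (\<lambda>a b. B (inv\<^bsub>G\<^esub> (snd a) \<otimes>\<^bsub>G\<^esub> snd b) (fst a) (fst b))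
      = (\<Prod>c\<in>irr_classes G. set_det (V \<times> {..<rep_dim G (rep c)})
           (tensor_kernel (carrier G) h B (rep c)) ^ rep_dim G (rep c))"
proof -
  interpret G: group G by fact
  let ?A = "{\<rho> :: 'g \<Rightarrow> 'k mat. irreducible_rep G \<rho>}"
  define R where "R = {(\<rho> :: 'g \<Rightarrow> 'k mat, \<sigma>). irreducible_rep G \<rho> \<and> irreducible_rep G \<sigma> \<and> equivalent_reps G \<rho> \<sigma>}"
  let ?C = "irr_classes G :: ('g \<Rightarrow> 'k mat) set set"
  let ?D = "\<lambda>\<rho>. set_det (V \<times> {..<rep_dim G \<rho>}) (tensor_kernel (carrier G) h B \<rho>)"
  define cls where "cls = (\<lambda>\<rho>. R `` {\<rho>})"
  have equiv: "equiv ?A R" unfolding R_def by (rule equiv_equivalent_reps)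
  have C: "?C = ?A // R" by (simp add: irr_classes_def R_def)
  have cls_rep: "cls (rep c) = c" and irr_rep: "irreducible_rep G (rep c)" if c: "c \<in> ?C" for c
  proof -
    obtain \<sigma> where \<sigma>: "\<sigma> \<in> ?A" "c = R `` {\<sigma>}" using c unfolding C by (auto elim: quotientE)
    then have "(\<sigma>, rep c) \<in> R" using rep c by auto
    then show "cls (rep c) = c" "irreducible_rep G (rep c)"
      using equiv_class_eq[OF equiv, of \<sigma> "rep c"] \<sigma>(2) by (auto simp: cls_def R_def)
  qed
  have cls_eq: "cls \<sigma> = c \<longleftrightarrow> equivalent_reps G (rep c) \<sigma>"
    if "c \<in> ?C" "irreducible_rep G \<sigma>" for c \<sigma>
    using equiv_class_eq_iff[OF equiv, of "rep c" \<sigma>] cls_rep[OF that(1)] irr_rep[OF that(1)] that(2)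
    by (auto simp: cls_def R_def)
  have clsC: "cls \<sigma> \<in> ?C" if "irreducible_rep G \<sigma>" for \<sigma>
    using that unfolding C cls_def by (intro quotientI) simp
  obtain \<rho> :: "'g \<Rightarrow> 'k mat" where \<rho>: "representation G \<rho>"
    "\<And>x. x \<in> carrier G \<Longrightarrow> mat_trace (\<rho> x) = (if x = \<one>\<^bsub>G\<^esub> then of_nat (card (carrier G)) else 0)"
    and reg: "\<And>B. set_det (V \<times> {..<rep_dim G \<rho>}) (tensor_kernel (carrier G) h B \<rho>)
      = set_det (V \<times> carrier G) (\<lambda>a b. B (inv\<^bsub>G\<^esub> (snd a) \<otimes>\<^bsub>G\<^esub> snd b) (fst a) (fst b))"
    by (rule regular_representation[OF G V h]) (rule that)
  obtain \<sigma>s where irr: "\<And>\<sigma>. \<sigma> \<in> set \<sigma>s \<Longrightarrow> irreducible_rep G \<sigma>"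
    and tr: "\<And>x. x \<in> carrier G \<Longrightarrow> mat_trace (\<rho> x) = (\<Sum>\<sigma>\<leftarrow>\<sigma>s. mat_trace (\<sigma> x))"
    and D: "\<And>B. set_det (V \<times> {..<rep_dim G \<rho>}) (tensor_kernel (carrier G) h B \<rho>)
      = (\<Prod>\<sigma>\<leftarrow>\<sigma>s. set_det (V \<times> {..<rep_dim G \<sigma>}) (tensor_kernel (carrier G) h B \<sigma>))"
    by (rule composition_series[OF G(1) \<rho>(1) G(2) V h]) (rule that)
  \<comment> \<open>The regular character is paired with that of \<open>\<tau>\<close> in two ways.
    Directly, only the identity contributes, with \<open>card (carrier G)\<close> times the
    dimension of \<open>\<tau>\<close>. Through the composition factors, each one equivalent to
    \<open>\<tau>\<close> contributes \<open>card (carrier G)\<close>, which is then cancelled in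
    the natural numbers.\<close>
  have count: "length (filter (equivalent_reps G \<tau>) \<sigma>s) = rep_dim G \<tau>" if \<tau>: "irreducible_rep G \<tau>" for \<tau>
  proof -
    have "of_nat (card (carrier G)) * of_nat (rep_dim G \<tau>)
        = (\<Sum>x\<in>carrier G. if x = \<one>\<^bsub>G\<^esub> then of_nat (card (carrier G)) * mat_trace (\<tau> (inv\<^bsub>G\<^esub> x)) else 0 :: 'k)"
      using G(2) by (simp add: representationD(2)[OF irreducible_repD(1)[OF \<tau>]] mat_trace_def)
    also have "\<dots> = (\<Sum>x\<in>carrier G. mat_trace (\<rho> x) * mat_trace (\<tau> (inv\<^bsub>G\<^esub> x)))"
      by (intro sum.cong) (auto simp: \<rho>(2))
    also have "\<dots> = (\<Sum>x\<in>carrier G. \<Sum>\<sigma>\<leftarrow>\<sigma>s. mat_trace (\<sigma> x) * mat_trace (\<tau> (inv\<^bsub>G\<^esub> x)))"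
      by (intro sum.cong) (simp_all add: tr sum_list_mult_const)
    also have "\<dots> = (\<Sum>\<sigma>\<leftarrow>\<sigma>s. \<Sum>x\<in>carrier G. mat_trace (\<sigma> x) * mat_trace (\<tau> (inv\<^bsub>G\<^esub> x)))"
      by (induction \<sigma>s) (simp_all add: sum.distrib)
    also have "\<dots> = (\<Sum>\<sigma>\<leftarrow>\<sigma>s. if equivalent_reps G \<tau> \<sigma> then of_nat (card (carrier G)) else 0)"
      using character_orthogonality[OF K G \<tau> irr] by (intro arg_cong[of _ _ sum_list] map_cong) auto
    also have "\<dots> = of_nat (card (carrier G)) * of_nat (length (filter (equivalent_reps G \<tau>) \<sigma>s))"
      by (induction \<sigma>s) (simp_all add: algebra_simps)
    finally have "of_nat (card (carrier G) * rep_dim G \<tau>)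
        = (of_nat (card (carrier G) * length (filter (equivalent_reps G \<tau>) \<sigma>s)) :: 'k)" by simp
    then have "card (carrier G) * rep_dim G \<tau> = card (carrier G) * length (filter (equivalent_reps G \<tau>) \<sigma>s)"
      by (simp only: of_nat_eq_iff)
    then show ?thesis using G(2) by (auto simp: card_eq_0_iff)
  qed
  have count_cls: "count_list (map cls \<sigma>s) c = rep_dim G (rep c)" if c: "c \<in> ?C" for c
  proof -
    have "count_list (map cls \<sigma>s) c = length (filter (\<lambda>\<sigma>. c = cls \<sigma>) \<sigma>s)"
      by (simp add: count_list_eq_length_filter filter_map o_def)
    also have "filter (\<lambda>\<sigma>. c = cls \<sigma>) \<sigma>s = filter (equivalent_reps G (rep c)) \<sigma>s"
      using cls_eq[OF c irr] by (intro filter_cong) auto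
    finally show ?thesis using count[OF irr_rep[OF c]] by simp
  qed
  show irr_rep': "irreducible_rep G (rep c)" if "c \<in> irr_classes G" for c by (rule irr_rep[OF that])
  \<comment> \<open>The multiplicity of a class is a positive dimension, so every class occurs in
    the finite list of composition factors; finiteness of the set of classes comes from
    here.\<close>
  have "?C \<subseteq> set (map cls \<sigma>s)"
  proof
    fix c assume c: "c \<in> ?C"
    then have "count_list (map cls \<sigma>s) c \<noteq> 0"
      using count_cls[OF c] irreducible_repD(2)[OF irr_rep[OF c]] by simp
    then show "c \<in> set (map cls \<sigma>s)" by (metis count_notin)
  qed
  then show fin: "finite ?C" by (rule finite_subset) simp
  \<comment> \<open>Equivalent representations are conjugate and give the same determinant, so each
    factor can be replaced by the chosen representative of its class.\<close>
  have "?D \<sigma> = ?D (rep (cls \<sigma>))" if \<sigma>: "\<sigma> \<in> set \<sigma>s" for \<sigma>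
  proof -
    let ?\<tau> = "rep (cls \<sigma>)"
    note c = clsC[OF irr[OF \<sigma>]]
    let ?n = "rep_dim G ?\<tau>"
    have "equivalent_reps G ?\<tau> \<sigma>" using cls_eq[OF c irr[OF \<sigma>]] by simp
    from equivalent_repsE[OF this irreducible_repD(1)[OF irr_rep[OF c]] irreducible_repD(1)[OF irr[OF \<sigma>]]]
    obtain P Q where PQ: "P \<in> carrier_mat ?n ?n" "Q \<in> carrier_mat ?n ?n" "P * Q = 1\<^sub>m ?n"
      "\<And>x. x \<in> carrier G \<Longrightarrow> \<sigma> x = P * ?\<tau> x * Q" and dim: "rep_dim G \<sigma> = ?n" by metis
    have "?D \<sigma> = set_det (V \<times> {..<?n}) (tensor_kernel (carrier G) h B (\<lambda>x. P * ?\<tau> x * Q))"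
      unfolding dim using V PQ(4) by (intro set_det_cong) (auto simp: tensor_kernel_def)
    also have "\<dots> = ?D ?\<tau>"
      by (rule set_det_tensor_kernel_conj)
        (use h V G(2) PQ representationD(1)[OF irreducible_repD(1)[OF irr_rep[OF c]]] in auto)
    finally show ?thesis .
  qed
  then have "(\<Prod>\<sigma>\<leftarrow>\<sigma>s. ?D \<sigma>) = prod_list (map (\<lambda>c. ?D (rep c)) (map cls \<sigma>s))"
    unfolding map_map o_def by (intro arg_cong[of _ _ prod_list] map_cong) auto
  also have "\<dots> = (\<Prod>c\<in>?C. ?D (rep c) ^ count_list (map cls \<sigma>s) c)"
    using clsC irr by (intro prod_list_eq_prod_count fin) auto
  also have "\<dots> = (\<Prod>c\<in>?C. ?D (rep c) ^ rep_dim G (rep c))"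
    by (intro prod.cong) (simp_all only: count_cls)
  finally show "set_det (V \<times> carrier G) (\<lambda>a b. B (inv\<^bsub>G\<^esub> (snd a) \<otimes>\<^bsub>G\<^esub> snd b) (fst a) (fst b))
      = (\<Prod>c\<in>?C. ?D (rep c) ^ rep_dim G (rep c))"
    using D[of B] reg[of B] by simp
qed

section \<open>Spectral polynomials of the cover\<close>

lemma comm_ring_hom_mps_const: "comm_ring_hom (mps_const :: 'k::comm_ring_1 \<Rightarrow> ('d::finite, 'k) mps)"
proof
  fix x y :: 'k
  show "mps_const 0 = (0 :: ('d, 'k) mps)" "mps_const 1 = (1 :: ('d, 'k) mps)"
    "mps_const (x + y) = (mps_const x + mps_const y :: ('d, 'k) mps)"
    by (auto intro!: mps_eqI simp: mps_const.rep_eq zero_mps.rep_eq one_mps.rep_eq plus_mps.rep_eq)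
  show "mps_const (x * y) = (mps_const x * mps_const y :: ('d, 'k) mps)"
  proof (rule mps_eqI)
    fix n :: "'d \<Rightarrow> nat"
    show "mps_coeff (mps_const (x * y)) n = mps_coeff (mps_const x * mps_const y) n"
    proof (cases "n = 0")
      case False
      have "mps_coeff (mps_const x * mps_const y) n = 0"
        unfolding mps_coeff_mult
        by (rule sum.neutral) (use False in \<open>auto simp: antidiag_def mps_const.rep_eq\<close>)
      with False show ?thesis by (simp add: mps_const.rep_eq)
    qed (simp add: mps_coeff_mult mps_const.rep_eq)
  qed
qed

lemma comm_ring_hom_const_poly: "comm_ring_hom (\<lambda>c :: 'k::comm_ring_1. [:mps_const c :: ('d::finite, 'k) mps:])"
proof -
  interpret m: comm_ring_hom "mps_const :: 'k \<Rightarrow> ('d, 'k) mps" by (rule comm_ring_hom_mps_const)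
  show ?thesis by unfold_locales (simp_all add: m.hom_add m.hom_mult)
qed

lemma spectral_det_eq_set_det:
  assumes e: "bij_betw e {..<n} S"
    and W: "W \<in> carrier_mat n n" "\<And>i j. i < n \<Longrightarrow> j < n \<Longrightarrow> W $$ (i, j) = F (e i) (e j)"
    and M: "M \<in> carrier_mat n n" "\<And>i j. i < n \<Longrightarrow> j < n \<Longrightarrow> M $$ (i, j) = (if i = j then D (e i) else 0)"
  shows "spectral_det W M
    = set_det S (\<lambda>a b. (if a = b then [:0, 1:] ^ 2 + [:D a:] else 0) - [:0, 1:] * [:F a b:])"
proof -
  have "e i = e j \<longleftrightarrow> i = j" if "i < n" "j < n" for i j
    using e that by (auto simp: bij_betw_def inj_on_def)
  then show ?thesis
    unfolding spectral_det_def set_det_eq[OF e] using W M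
    by (intro arg_cong[of _ _ det] eq_matI) auto
qed

lemma weight_degree_minus_one_entry:
  assumes "i < length vs" "j < length vs"
  shows "map_mat mps_const (weight_degree_mat X vs w - 1\<^sub>m (length vs)) $$ (i, j)
    = (if i = j then mps_const ((\<Sum>e\<in>out_arcs X (vs ! i). w e) - 1) else (0 :: ('d::finite, 'k::field) mps))"
proof -
  interpret m: comm_ring_hom "mps_const :: 'k \<Rightarrow> ('d, 'k) mps" by (rule comm_ring_hom_mps_const)
  show ?thesis using assms by (simp add: weight_degree_mat_def m.hom_zero)
qed

lemma spectral_poly_eq_set_det:
  assumes "distinct vs" "set vs = verts X"
  shows "spectral_poly \<iota> X vs w \<alpha> = set_det (verts X)
    (\<lambda>u v. (if u = v then [:0, 1:] ^ 2 + [:mps_const ((\<Sum>e\<in>out_arcs X u. w e) - 1):] else 0)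
       - [:0, 1:] * [:\<Sum>e | e \<in> arcs X \<and> tail X e = u \<and> head X e = v. voltage_weight \<iota> w \<alpha> e:])"
  unfolding spectral_poly_def
proof (rule spectral_det_eq_set_det)
  show "bij_betw ((!) vs) {..<length vs} (verts X)"
    using bij_betw_nth[OF assms(1) refl assms(2)[symmetric]] .
  show "map_mat mps_const (weight_degree_mat X vs w - 1\<^sub>m (length vs)) $$ (i, j)
      = (if i = j then mps_const ((\<Sum>e\<in>out_arcs X (vs ! i). w e) - 1) else 0)"
    if "i < length vs" "j < length vs" for i j
    using that by (rule weight_degree_minus_one_entry)
qed (auto simp: weighted_adjacency_mat_def weight_degree_mat_def)

text \<open>The coefficient at \<open>x\<close> of the matrix \<open>A^2 I - A W + D - I\<close>
  read over the group algebra: the terms without edges sit at the identity, and an edge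
  \<open>e\<close> contributes at \<open>\<beta> e\<close>.\<close>

definition spectral_coeff ::
    "('p::prime_card padic \<Rightarrow> 'k::field) \<Rightarrow> ('v, 'e) pre_digraph \<Rightarrow> ('e \<Rightarrow> 'k) \<Rightarrow>
      ('e \<Rightarrow> 'd::finite \<Rightarrow> 'p padic_int) \<Rightarrow> ('g, 'm) monoid_scheme \<Rightarrow> ('e \<Rightarrow> 'g) \<Rightarrow>
      'g \<Rightarrow> 'v \<Rightarrow> 'v \<Rightarrow> ('d, 'k) mps poly" where
  "spectral_coeff \<iota> X w \<alpha> G \<beta> x u v =
     (if x = \<one>\<^bsub>G\<^esub> \<and> u = v then [:0, 1:] ^ 2 + [:mps_const ((\<Sum>e\<in>out_arcs X u. w e) - 1):] else 0)
     - [:0, 1:] * [:\<Sum>e | e \<in> arcs X \<and> tail X e = u \<and> head X e = v \<and> \<beta> e = x. voltage_weight \<iota> w \<alpha> e:]"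

lemma sum_const_poly: "(\<Sum>x\<in>A. [:f x:]) = [:\<Sum>x\<in>A. f x:]"
  by (induction A rule: infinite_finite_induct) simp_all

text \<open>Grouping the edges from \<open>u\<close> to \<open>v\<close> by their value under
  \<open>\<beta>\<close> turns the block, a sum over edges, into a sum over group elements. The
  diagonal terms sit at the identity, where \<open>\<rho>\<close> is the identity matrix; this
  produces the Kronecker product with \<open>I\<close>.\<close>

lemma twisted_spectral_poly_eq_set_det:
  fixes X :: "('v, 'e) pre_digraph"
    and w :: "'e \<Rightarrow> 'k::field" and \<alpha> :: "'e \<Rightarrow> 'd::finite \<Rightarrow> 'p::prime_card padic_int"
  assumes vs: "distinct vs" "set vs = verts X" and X: "fin_digraph X"
    and G: "group G" "finite (carrier G)" and \<beta>: "\<forall>e\<in>arcs X. \<beta> e \<in> carrier G"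
    and \<rho>: "representation G \<rho>"
  shows "twisted_spectral_poly \<iota> X vs w \<alpha> G \<beta> \<rho> = set_det (verts X \<times> {..<rep_dim G \<rho>})
    (tensor_kernel (carrier G) (\<lambda>c. [:mps_const c:]) (spectral_coeff \<iota> X w \<alpha> G \<beta>) \<rho>)"
proof -
  interpret X: fin_digraph X by (rule X)
  interpret G: group G by fact
  let ?h = "\<lambda>c :: 'k. [:mps_const c :: ('d, 'k) mps:]"
  interpret h: comm_ring_hom ?h by (rule comm_ring_hom_const_poly)
  interpret m: comm_ring_hom "mps_const :: 'k \<Rightarrow> ('d, 'k) mps" by (rule comm_ring_hom_mps_const)
  define n where "n = rep_dim G \<rho>"
  define N where "N = length vs"
  define E where "E = (\<lambda>u v. {e \<in> arcs X. tail X e = u \<and> head X e = v})"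
  have finE: "finite (E u v)" for u v unfolding E_def by simp
  define D :: "'v \<Rightarrow> ('d, 'k) mps" where "D = (\<lambda>u. mps_const ((\<Sum>e\<in>out_arcs X u. w e) - 1))"
  define F where "F = (\<lambda>a b. \<Sum>e\<in>E (fst a) (fst b). voltage_weight \<iota> w \<alpha> e * mps_const (\<rho> (\<beta> e) $$ (snd a, snd b)))"
  note \<rho>' = representationD[OF \<rho>, folded n_def]
  define e where "e = (\<lambda>r. (vs ! (r div n), r mod n))"
  have idx: "r div n < N" "r mod n < n" if "r < N * n" for r
  proof -
    have "n > 0" using that by (cases n) auto
    then show "r div n < N" "r mod n < n" using that by (simp_all add: less_mult_imp_div_less)
  qed
  have bvs: "bij_betw ((!) vs) {..<N} (verts X)"
    using bij_betw_nth[OF vs(1) refl vs(2)[symmetric]] by (simp add: N_def)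
  have e: "bij_betw e {..<N * n} (verts X \<times> {..<n})"
  proof -
    have "bij_betw (\<lambda>r. (r div n, r mod n)) {..<N * n} ({..<N} \<times> {..<n})"
    proof (rule bij_betw_byWitness[of _ "\<lambda>(i, j). i * n + j"])
      show "(\<lambda>(i, j). i * n + j) ` ({..<N} \<times> {..<n}) \<subseteq> {..<N * n}"
      proof clarsimp
        fix i j assume "i < N" "j < n"
        then have "i * n + j < Suc i * n" by simp
        also have "\<dots> \<le> N * n" using \<open>i < N\<close> by (intro mult_le_mono1) simp
        finally show "i * n + j < N * n" .
      qed
    qed (auto simp: idx)
    from bij_betw_trans[OF this bij_betw_map_prod[OF bvs bij_betw_id]]
    show ?thesis by (simp add: o_def e_def id_def)
  qed
  have "twisted_spectral_poly \<iota> X vs w \<alpha> G \<beta> \<rho> = set_det (verts X \<times> {..<n})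
      (\<lambda>a b. (if a = b then [:0, 1:] ^ 2 + [:D (fst a):] else 0) - [:0, 1:] * [:F a b:])"
    unfolding twisted_spectral_poly_def n_def[symmetric]
  proof (rule spectral_det_eq_set_det[OF e])
    let ?W = "twisted_adjacency_mat X vs n (voltage_weight \<iota> w \<alpha>) (\<lambda>e. map_mat mps_const (\<rho> (\<beta> e)))"
    show "?W \<in> carrier_mat (N * n) (N * n)" by (simp add: twisted_adjacency_mat_def N_def)
    show "?W $$ (r, c) = F (e r) (e c)" if rc: "r < N * n" "c < N * n" for r c
    proof -
      have "map_mat mps_const (\<rho> (\<beta> a)) $$ (r mod n, c mod n) = (mps_const :: 'k \<Rightarrow> ('d, 'k) mps) (\<rho> (\<beta> a) $$ (r mod n, c mod n))"
        if "a \<in> arcs X" for a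
        using \<rho>'(1)[of "\<beta> a"] \<beta> that idx(2)[OF rc(1)] idx(2)[OF rc(2)] by auto
      then show ?thesis
        using rc by (auto simp: twisted_adjacency_mat_def F_def e_def N_def E_def intro!: sum.cong)
    qed
    let ?K = "kronecker (weight_degree_mat X vs w - 1\<^sub>m (length vs)) (1\<^sub>m n)"
    show "map_mat mps_const ?K \<in> carrier_mat (N * n) (N * n)"
      by (simp add: kronecker_def N_def weight_degree_mat_def)
    show "map_mat mps_const ?K $$ (r, c) = (if r = c then D (fst (e r)) else 0)"
      if rc: "r < N * n" "c < N * n" for r c
    proof -
      have "r = c \<longleftrightarrow> r div n = c div n \<and> r mod n = c mod n"
        by (metis div_mult_mod_eq)
      then show ?thesis
        using rc idx[OF rc(1)] idx[OF rc(2)]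
        by (auto simp: kronecker_def N_def weight_degree_mat_def D_def e_def)
    qed
  qed
  also have "\<dots> = set_det (verts X \<times> {..<n}) (tensor_kernel (carrier G) ?h (spectral_coeff \<iota> X w \<alpha> G \<beta>) \<rho>)"
  proof (rule set_det_cong)
    fix a b assume "a \<in> verts X \<times> {..<n}" "b \<in> verts X \<times> {..<n}"
    then obtain u i v j where ab: "a = (u, i)" "b = (v, j)" and ij: "i < n" "j < n" by auto
    define \<delta> where "\<delta> = (if u = v then [:0, 1:] ^ 2 + [:D u:] else 0)"
    define S where "S = (\<lambda>x. \<Sum>e\<in>{e \<in> E u v. \<beta> e = x}. voltage_weight \<iota> w \<alpha> e)"
    have coeff: "spectral_coeff \<iota> X w \<alpha> G \<beta> x u v = (if x = \<one>\<^bsub>G\<^esub> then \<delta> else 0) - [:0, 1:] * [:S x:]" for x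
      by (auto simp: spectral_coeff_def \<delta>_def D_def S_def E_def conj_assoc)
    have distrib: "((if A then p else 0) - [:0, 1:] * [:s:]) * [:r:] = (if A then p * [:r:] else 0) - [:0, 1:] * [:s * r:]"
      for A and p :: "('d, 'k) mps poly" and s r
    proof -
      have "[:s * r:] = [:s:] * [:r:]" by simp
      then show ?thesis by (simp only: left_diff_distrib mult.assoc if_distrib[of "\<lambda>t. t * _"] mult_zero_left)
    qed
    have "tensor_kernel (carrier G) ?h (spectral_coeff \<iota> X w \<alpha> G \<beta>) \<rho> a b
        = (\<Sum>x\<in>carrier G. (if x = \<one>\<^bsub>G\<^esub> then \<delta> * ?h (\<rho> x $$ (i, j)) else 0) - [:0, 1:] * [:S x * mps_const (\<rho> x $$ (i, j)):])"
      unfolding tensor_kernel_def ab fst_conv snd_conv coeff by (intro sum.cong refl distrib)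
    also have "\<dots> = \<delta> * ?h (\<rho> \<one>\<^bsub>G\<^esub> $$ (i, j)) - [:0, 1:] * (\<Sum>x\<in>carrier G. [:S x * mps_const (\<rho> x $$ (i, j)):])"
      using G(2) by (simp add: sum_subtractf sum_distrib_left)
    also have "(\<Sum>x\<in>carrier G. [:S x * mps_const (\<rho> x $$ (i, j)):]) = [:\<Sum>x\<in>carrier G. S x * mps_const (\<rho> x $$ (i, j)):]"
      by (rule sum_const_poly)
    also have "(\<Sum>x\<in>carrier G. S x * mps_const (\<rho> x $$ (i, j)))
        = (\<Sum>x\<in>carrier G. \<Sum>e\<in>{e \<in> E u v. \<beta> e = x}. voltage_weight \<iota> w \<alpha> e * mps_const (\<rho> (\<beta> e) $$ (i, j)))"
      by (auto simp: S_def sum_distrib_right intro!: sum.cong)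
    also have "\<dots> = F a b"
      unfolding F_def using \<beta> by (subst sum.group[OF finE G(2)]) (auto simp: ab E_def)
    also have "\<delta> * ?h (\<rho> \<one>\<^bsub>G\<^esub> $$ (i, j)) = (if a = b then [:0, 1:] ^ 2 + [:D (fst a):] else 0)"
      using ij by (auto simp: \<rho>'(2) ab \<delta>_def)
    finally show "(if a = b then [:0, 1:] ^ 2 + [:D (fst a):] else 0) - [:0, 1:] * [:F a b:]
        = tensor_kernel (carrier G) ?h (spectral_coeff \<iota> X w \<alpha> G \<beta>) \<rho> a b" ..
  qed simp
  finally show ?thesis by (simp add: n_def)
qed

lemma sum_out_arcs_derived_digraph:
  assumes "g \<in> carrier G"
  shows "(\<Sum>a\<in>out_arcs (derived_digraph X G \<beta>) (u, g). (w \<circ> fst) a) = (\<Sum>e\<in>out_arcs X u. w e)"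
  by (rule sum.reindex_bij_witness[of _ "\<lambda>e. (e, g)" fst])
    (use assms in \<open>auto simp: out_arcs_def derived_digraph_def\<close>)

text \<open>The lift of \<open>e\<close> that starts over \<open>g\<close> ends over
  \<open>g \<otimes> \<beta> e\<close>. The edges from \<open>(u, g)\<close> to
  \<open>(v, k)\<close> therefore correspond to the edges from \<open>u\<close> to \<open>v\<close>
  with \<open>\<beta> e = g^-1 k\<close>, and the diagonal condition \<open>(u, g) = (v, k)\<close>
  becomes \<open>u = v\<close> together with \<open>g^-1 k\<close> being the identity.\<close>

lemma spectral_poly_derived_digraph:
  assumes ys: "distinct ys" "set ys = verts (derived_digraph X G \<beta>)" and X: "fin_digraph X"
    and G: "group G" "finite (carrier G)" and \<beta>: "\<forall>e\<in>arcs X. \<beta> e \<in> carrier G"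
  shows "spectral_poly \<iota> (derived_digraph X G \<beta>) ys (w \<circ> fst) (\<alpha> \<circ> fst) = set_det (verts X \<times> carrier G)
    (\<lambda>a b. spectral_coeff \<iota> X w \<alpha> G \<beta> (inv\<^bsub>G\<^esub> (snd a) \<otimes>\<^bsub>G\<^esub> snd b) (fst a) (fst b))"
proof -
  interpret X: fin_digraph X by (rule X)
  interpret G: group G by fact
  have verts: "verts (derived_digraph X G \<beta>) = verts X \<times> carrier G" by (simp add: derived_digraph_def)
  show ?thesis
    unfolding spectral_poly_eq_set_det[OF ys] unfolding verts
  proof (rule set_det_cong)
    fix a b assume "a \<in> verts X \<times> carrier G" "b \<in> verts X \<times> carrier G"
    then obtain u g v k where ab: "a = (u, g)" "b = (v, k)" and gk: "g \<in> carrier G" "k \<in> carrier G" by auto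
    have solve: "g \<otimes>\<^bsub>G\<^esub> x = k \<longleftrightarrow> x = inv\<^bsub>G\<^esub> g \<otimes>\<^bsub>G\<^esub> k" if "x \<in> carrier G" for x
      using gk that by (metis G.inv_solve_left)
    have eq: "inv\<^bsub>G\<^esub> g \<otimes>\<^bsub>G\<^esub> k = \<one>\<^bsub>G\<^esub> \<longleftrightarrow> g = k"
      using solve[OF G.one_closed] G.r_one[OF gk(1)] by metis
    have cancel: "inv\<^bsub>G\<^esub> g \<otimes>\<^bsub>G\<^esub> (g \<otimes>\<^bsub>G\<^esub> x) = x" if "x \<in> carrier G" for x
      using gk that by (simp add: G.m_assoc[symmetric])
    let ?Y = "derived_digraph X G \<beta>"
    have "(\<Sum>e | e \<in> arcs ?Y \<and> tail ?Y e = a \<and> head ?Y e = b. voltage_weight \<iota> (w \<circ> fst) (\<alpha> \<circ> fst) e)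
        = (\<Sum>e | e \<in> arcs X \<and> tail X e = u \<and> head X e = v \<and> \<beta> e = inv\<^bsub>G\<^esub> g \<otimes>\<^bsub>G\<^esub> k. voltage_weight \<iota> w \<alpha> e)"
      by (rule sum.reindex_bij_witness[of _ "\<lambda>e. (e, g)" fst])
        (use gk \<beta> solve in \<open>auto simp: derived_digraph_def ab voltage_weight_def cancel\<close>)
    then show "(if a = b then [:0, 1:] ^ 2 + [:mps_const ((\<Sum>e\<in>out_arcs ?Y a. (w \<circ> fst) e) - 1):] else 0)
        - [:0, 1:] * [:\<Sum>e | e \<in> arcs ?Y \<and> tail ?Y e = a \<and> head ?Y e = b. voltage_weight \<iota> (w \<circ> fst) (\<alpha> \<circ> fst) e:]
        = spectral_coeff \<iota> X w \<alpha> G \<beta> (inv\<^bsub>G\<^esub> (snd a) \<otimes>\<^bsub>G\<^esub> snd b) (fst a) (fst b)"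
      using sum_out_arcs_derived_digraph[OF gk(1), where X = X and \<beta> = \<beta> and u = u and w = w]
      by (auto simp: ab spectral_coeff_def eq)
  qed (use G(2) in simp)
qed

text \<open>The Grover weights sum to \<open>2\<close> at every vertex, so the constant term of the polynomial is \<open>det I\<close>.\<close>

lemma spectral_poly_nonzero:
  fixes w :: "'e \<Rightarrow> 'k::field" and \<alpha> :: "'e \<Rightarrow> 'd::finite \<Rightarrow> 'p::prime_card padic_int"
  assumes vs: "distinct vs" "set vs = verts X" "finite (verts X)"
    and w: "\<And>u. u \<in> verts X \<Longrightarrow> (\<Sum>e\<in>out_arcs X u. w e) = 2"
  shows "spectral_poly \<iota> X vs w \<alpha> \<noteq> 0"
proof -
  have p: "comm_ring_hom (\<lambda>p :: ('d, 'k) mps poly. poly p 0)" by unfold_locales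
  interpret m: comm_ring_hom "mps_const :: 'k \<Rightarrow> ('d, 'k) mps" by (rule comm_ring_hom_mps_const)
  \<comment> \<open>Evaluation at \<open>A = 0\<close> is a ring homomorphism and so commutes with
    the determinant; the diagonal entries become \<open>2 - 1\<close>.\<close>
  have "poly (spectral_poly \<iota> X vs w \<alpha>) 0 = set_det (verts X) (\<lambda>u v. if u = v then 1 else 0)"
    unfolding spectral_poly_eq_set_det[OF vs(1,2)] comm_ring_hom.set_det_hom[OF p vs(3)]
    by (rule set_det_cong[OF vs(3)]) (auto simp: w)
  also have "\<dots> = 1" by (rule set_det_delta[OF vs(3)])
  finally show ?thesis by auto
qed

section \<open>Multiplicativity of the resultant in its first argument\<close>

lemma res_roots_mult:
  assumes "f \<noteq> 0" "g \<noteq> 0"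
  shows "res_roots (f * g) h = res_roots f h * res_roots g h"
  using assms by (simp add: res_roots_def proots_mult lead_coeff_mult power_mult_distrib mult_ac)

text \<open>In the algebraic closure of the fraction field a resultant is a product over roots, and
  the multiset of roots of a product of nonzero polynomials is the sum of the two multisets. The
  embedding is injective, so the identity descends.\<close>

lemma resultant_mult_left:
  fixes f g h :: "'a::idom poly"
  assumes "f \<noteq> 0" "g \<noteq> 0"
  shows "resultant (f * g) h = resultant f h * resultant g h"
proof -
  let ?\<iota> = "\<lambda>x :: 'a. to_ac (to_fract x)"
  interpret p: map_poly_inj_comm_ring_hom ?\<iota> ..
  let ?m = "map_poly ?\<iota>"
  have nz: "?m f \<noteq> 0" "?m g \<noteq> 0" "?m (f * g) \<noteq> 0"
    using assms by simp_all
  have mult: "?m (f * g) = ?m f * ?m g"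
    by (rule p.hom_mult)
  have "?\<iota> (resultant (f * g) h) = res_roots (?m (f * g)) (?m h)"
    unfolding to_ac_fract.resultant_hom[symmetric] by (rule resultant_eq_res_roots[OF nz(3)])
  also have "\<dots> = res_roots (?m f) (?m h) * res_roots (?m g) (?m h)"
    unfolding mult by (rule res_roots_mult[OF nz(1,2)])
  also have "\<dots> = ?\<iota> (resultant f h) * ?\<iota> (resultant g h)"
    unfolding to_ac_fract.resultant_hom[symmetric] by (simp only: resultant_eq_res_roots[OF nz(1)] resultant_eq_res_roots[OF nz(2)])
  also have "\<dots> = ?\<iota> (resultant f h * resultant g h)"
    by (rule to_ac_fract.hom_mult[symmetric])
  finally show ?thesis by (simp only: to_ac_fract.eq_iff)
qed

lemma resultant_one_left [simp]: "resultant (1 :: 'a::idom poly) h = 1"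
  using resultant_const(1)[of 1 h] by simp

lemma resultant_power_left:
  fixes f h :: "'a::idom poly"
  assumes "f \<noteq> 0"
  shows "resultant (f ^ n) h = resultant f h ^ n"
  using assms by (induction n) (simp_all add: resultant_mult_left)

lemma resultant_prod_left:
  fixes f :: "'b \<Rightarrow> 'a::idom poly"
  assumes "\<And>c. c \<in> C \<Longrightarrow> f c \<noteq> 0"
  shows "resultant (\<Prod>c\<in>C. f c) h = (\<Prod>c\<in>C. resultant (f c) h)"
  using assms by (induction C rule: infinite_finite_induct) (simp_all add: resultant_mult_left)

theorem proposition5p1:
  fixes X :: "('v, 'e) pre_digraph" and arev :: "'e \<Rightarrow> 'e"
    and \<alpha> :: "'e \<Rightarrow> 'd::finite \<Rightarrow> 'p::prime_card padic_int"
    and G :: "('g, 'm) monoid_scheme" and \<beta> :: "'e \<Rightarrow> 'g"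
    and Y :: "('v \<times> 'g, 'e \<times> 'g) pre_digraph"
    and \<iota> :: "'p padic \<Rightarrow> 'k::field_char_0"
    and w :: "'e \<Rightarrow> 'k"
    and rep :: "('g \<Rightarrow> 'k mat) set \<Rightarrow> 'g \<Rightarrow> 'k mat"
    and vs :: "'v list" and ys :: "('v \<times> 'g) list"
  assumes X: "fin_digraph X" "bidirected_digraph X arev" "Digraph_Component.connected X"
      "\<forall>v\<in>verts X. out_degree X v \<ge> 1"
    and \<alpha>: "\<forall>e\<in>arcs X. \<alpha> (arev e) = - \<alpha> e"
    and G: "group G" "finite (carrier G)"
    and \<beta>: "\<forall>e\<in>arcs X. \<beta> e \<in> carrier G" "\<forall>e\<in>arcs X. \<beta> (arev e) = inv\<^bsub>G\<^esub> (\<beta> e)"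
    and Y: "Y = derived_digraph X G \<beta>" "Digraph_Component.connected Y"
    and w: "w = grover_weight X"
    and K: "finite_extension \<iota>" "splitting_field TYPE('k) G"
    and rep: "\<forall>c\<in>irr_classes G. rep c \<in> c"
    and vs: "distinct vs" "set vs = verts X"
    and ys: "distinct ys" "set ys = verts Y"
  shows "spectral_poly \<iota> Y ys (w \<circ> fst) (\<alpha> \<circ> fst)
      = (\<Prod>c\<in>irr_classes G. twisted_spectral_poly \<iota> X vs w \<alpha> G \<beta> (rep c) ^ rep_dim G (rep c))
    \<and> (\<forall>P :: 'k poly. monic P \<longrightarrow>
        resultant (spectral_poly \<iota> Y ys (w \<circ> fst) (\<alpha> \<circ> fst)) (map_poly mps_const P)
        = (\<Prod>c\<in>irr_classes G.
            resultant (twisted_spectral_poly \<iota> X vs w \<alpha> G \<beta> (rep c)) (map_poly mps_const P)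
              ^ rep_dim G (rep c)))"
proof -
  interpret X: fin_digraph X by (rule X(1))
  let ?t = "\<lambda>c. twisted_spectral_poly \<iota> X vs w \<alpha> G \<beta> (rep c)"
  \<comment> \<open>Here \<open>h\<close> sends a scalar to the constant polynomial over the power
    series; the free \<open>B\<close> is to become \<open>spectral_coeff\<close>.\<close>
  note det = group_algebra_determinant[OF G K(2) rep X.finite_verts comm_ring_hom_const_poly[where 'd = 'd]]
  have prod: "spectral_poly \<iota> Y ys (w \<circ> fst) (\<alpha> \<circ> fst) = (\<Prod>c\<in>irr_classes G. ?t c ^ rep_dim G (rep c))"
    unfolding Y(1) spectral_poly_derived_digraph[OF ys[unfolded Y(1)] X(1) G \<beta>(1)] det(3)
    by (intro prod.cong refl)
      (simp add: twisted_spectral_poly_eq_set_det[OF vs X(1) G \<beta>(1) irreducible_repD(1)[OF det(2)]])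
  have sum_w: "(\<Sum>e\<in>out_arcs X u. w e) = 2" if u: "u \<in> verts X" for u
  proof -
    have "(\<Sum>e\<in>out_arcs X u. w e) = (\<Sum>e\<in>out_arcs X u. 2 / of_nat (out_degree X u))"
      by (intro sum.cong) (auto simp: w grover_weight_def)
    \<comment> \<open>The out-degree is positive, hence nonzero in characteristic 0, and cancels
      against the number of summands.\<close>
    then show ?thesis using X(4) u by (fastforce simp: out_degree_def)
  qed
  have "spectral_poly \<iota> Y ys (w \<circ> fst) (\<alpha> \<circ> fst) \<noteq> 0"
  proof (rule spectral_poly_nonzero[OF ys])
    show "finite (verts Y)" using ys(2) by (metis List.finite_set)
    fix a assume "a \<in> verts Y"
    then obtain u g where a: "a = (u, g)" "u \<in> verts X" "g \<in> carrier G"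
      by (auto simp: Y(1) derived_digraph_def)
    show "(\<Sum>e\<in>out_arcs Y a. (w \<circ> fst) e) = 2"
      unfolding a(1) Y(1) sum_out_arcs_derived_digraph[OF a(3)] by (rule sum_w[OF a(2)])
  qed
  \<comment> \<open>A vanishing factor would enter the finite product with the positive exponent
    \<open>rep_dim G (rep c)\<close> and annihilate it.\<close>
  then have nz: "?t c \<noteq> 0" if "c \<in> irr_classes G" for c
    using that det(1) irreducible_repD(2)[OF det(2)[OF that]] unfolding prod by auto
  have "resultant (spectral_poly \<iota> Y ys (w \<circ> fst) (\<alpha> \<circ> fst)) Q
      = (\<Prod>c\<in>irr_classes G. resultant (?t c) Q ^ rep_dim G (rep c))" for Q
    unfolding prod by (simp add: resultant_prod_left resultant_power_left nz)
  with prod show ?thesis by blast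
qed

end
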